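(* Let $\mathbb{F}$ be any field of characteristic $0$, let $A$ be an abelian group, $T$ a vector space over $\mathbb{F}$, and $\varphi: T\times A\to\mathbb{F}$ a map that is $\mathbb{F}$-linear in the first variable and additive in the second, such that the generalized Witt algebra $W(A,T,\varphi)$ is a simple Lie algebra. Then every invertible local automorphism of $W(A,T,\varphi)$ is an automorphism of the Lie algebra $W(A,T,\varphi)$.
   Context: Generalized Witt algebra: given an abelian group $A$, a field $\mathbb{F}$, an $\mathbb{F}$-vector space $T$ and a map $\varphi:T\times A\to\mathbb{F}$ that is $\mathbb{F}$-linear in the first variable and additive in the second, let $\mathbb{F}A$ be the group algebra with basis $t^\alpha$ ($\alpha\in A$), $t^\alpha t^\beta=t^{\alpha+\beta}$. Then $W(A,T,\varphi)=\mathbb{F}A\otimes_{\mathbb{F}}T$, with $t^\alpha\partial:=t^\alpha\otimes\partial$, is the Lie algebra over $\mathbb{F}$ with bracket $$[t^\alpha\partial,t^\beta\partial']=t^{\alpha+\beta}\big(\varphi(\partial,\beta)\partial'-\varphi(\partial',\alpha)\partial\big),\quad \alpha,\beta\in A,\ \partial,\partial'\in T.$$ (In characteristic $0$ it is known that $W(A,T,\varphi)$ is simple if and only if $A\ne 0$ and $\varphi$ is nondegenerate, i.e. $\varphi(\partial,\alpha)=0$ for all $\partial\in T$ implies $\alpha=0$, and $\varphi(\partial,\alpha)=0$ for all $\alpha\in A$ implies $\partial=0$.) An automorphism of a Lie algebra $L$ is an invertible linear map $\theta:L\to L$ with $\theta([x,y])=[\theta(x),\theta(y)]$ for all $x,y\in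 L$. A local automorphism of $L$ is a linear map $\Phi:L\to L$ such that for every $x\in L$ there is an automorphism $\theta_x$ of $L$ (depending on $x$) with $\Phi(x)=\theta_x(x)$. *)

theory Defs
  imports Complex_Main "HOL-Library.Poly_Mapping"
begin

text \<open>
  Lie algebras over a field, with the whole type \<^typ>\<open>'v\<close> as carrier. A Lie algebra is
  simple if it is not abelian and its only ideals are zero and the whole algebra.
\<close>

locale lie_algebra = vector_space scale
  for scale :: "'k::field \<Rightarrow> 'v::ab_group_add \<Rightarrow> 'v" +
  fixes bracket :: "'v \<Rightarrow> 'v \<Rightarrow> 'v"
  assumes linear_left: "Vector_Spaces.linear scale scale (\<lambda>x. bracket x y)"
    and linear_right: "Vector_Spaces.linear scale scale (\<lambda>y. bracket x y)"
    and alternating: "bracket x x = 0"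
    and jacobi: "bracket x (bracket y z) + bracket y (bracket z x) + bracket z (bracket x y) = 0"

definition lie_ideal ::
    "('k::field \<Rightarrow> 'v::ab_group_add \<Rightarrow> 'v) \<Rightarrow> ('v \<Rightarrow> 'v \<Rightarrow> 'v) \<Rightarrow> 'v set \<Rightarrow> bool"
  where "lie_ideal scale bracket I \<longleftrightarrow>
    module.subspace scale I \<and> (\<forall>x. \<forall>y\<in>I. bracket x y \<in> I)"

locale simple_lie_algebra = lie_algebra scale bracket
  for scale :: "'k::field \<Rightarrow> 'v::ab_group_add \<Rightarrow> 'v" and bracket :: "'v \<Rightarrow> 'v \<Rightarrow> 'v" +
  assumes nonabelian: "\<exists>x y. bracket x y \<noteq> 0"
    and ideal_trivial: "lie_ideal scale bracket I \<Longrightarrow> I = {0} \<or> I = UNIV"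

definition lie_automorphism ::
    "('k::field \<Rightarrow> 'v::ab_group_add \<Rightarrow> 'v) \<Rightarrow> ('v \<Rightarrow> 'v \<Rightarrow> 'v) \<Rightarrow> ('v \<Rightarrow> 'v) \<Rightarrow> bool"
  where "lie_automorphism scale bracket \<theta> \<longleftrightarrow>
    Vector_Spaces.linear scale scale \<theta> \<and> bij \<theta> \<and>
    (\<forall>x y. \<theta> (bracket x y) = bracket (\<theta> x) (\<theta> y))"

definition local_lie_automorphism ::
    "('k::field \<Rightarrow> 'v::ab_group_add \<Rightarrow> 'v) \<Rightarrow> ('v \<Rightarrow> 'v \<Rightarrow> 'v) \<Rightarrow> ('v \<Rightarrow> 'v) \<Rightarrow> bool"
  where "local_lie_automorphism scale bracket \<Phi> \<longleftrightarrow>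
    Vector_Spaces.linear scale scale \<Phi> \<and>
    (\<forall>x. \<exists>\<theta>. lie_automorphism scale bracket \<theta> \<and> \<Phi> x = \<theta> x)"

text \<open>
  The data \<open>(A, T, \<phi>)\<close>: the abelian group \<open>A\<close> is the type \<^typ>\<open>'a\<close> and the vector space
  \<open>T\<close> is the type \<^typ>\<open>'t\<close> with scalar multiplication \<open>scaleT\<close>.
\<close>

locale witt_datum = vector_space scaleT
  for scaleT :: "'k::field \<Rightarrow> 't::ab_group_add \<Rightarrow> 't" +
  fixes \<phi> :: "'t \<Rightarrow> 'a::ab_group_add \<Rightarrow> 'k"
  assumes phi_linear: "Vector_Spaces.linear scaleT (*) (\<lambda>d. \<phi> d a)"
    and phi_add: "\<phi> d (a + b) = \<phi> d a + \<phi> d b"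

text \<open>
  Since the group algebra \<open>\<F>A\<close> has basis \<open>t\<^sup>\<alpha>\<close>, the tensor product \<open>\<F>A \<otimes> T\<close> is the direct sum
  of the spaces \<open>t\<^sup>\<alpha> \<otimes> T\<close>, each a copy of \<open>T\<close>. It is represented by the finitely supported
  functions from \<open>A\<close> to \<open>T\<close>, with \<open>t\<^sup>\<alpha>\<partial>\<close> given by \<open>Poly_Mapping.single \<alpha> \<partial>\<close>. The bracket is
  the biadditive extension of its values on these elements.
\<close>

definition witt_scale ::
    "('k::field \<Rightarrow> 't::ab_group_add \<Rightarrow> 't) \<Rightarrow> 'k \<Rightarrow> ('a \<Rightarrow>\<^sub>0 't) \<Rightarrow> ('a \<Rightarrow>\<^sub>0 't)"
  where "witt_scale scaleT c x = Poly_Mapping.map (scaleT c) x"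

definition witt_bracket ::
    "('k::field \<Rightarrow> 't::ab_group_add \<Rightarrow> 't) \<Rightarrow> ('t \<Rightarrow> 'a::ab_group_add \<Rightarrow> 'k) \<Rightarrow>
     ('a \<Rightarrow>\<^sub>0 't) \<Rightarrow> ('a \<Rightarrow>\<^sub>0 't) \<Rightarrow> ('a \<Rightarrow>\<^sub>0 't)"
  where "witt_bracket scaleT \<phi> x y =
    (\<Sum>\<alpha>\<in>Poly_Mapping.keys x. \<Sum>\<beta>\<in>Poly_Mapping.keys y.
       Poly_Mapping.single (\<alpha> + \<beta>)
         (scaleT (\<phi> (Poly_Mapping.lookup x \<alpha>) \<beta>) (Poly_Mapping.lookup y \<beta>) -
          scaleT (\<phi> (Poly_Mapping.lookup y \<beta>) \<alpha>) (Poly_Mapping.lookup x \<alpha>)))"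

lemma poly_mapping_additive_induct:
  fixes x :: "'a \<Rightarrow>\<^sub>0 't::comm_monoid_add"
  assumes zero: "P 0" and single: "\<And>a d. P (Poly_Mapping.single a d)"
    and add: "\<And>x y. P x \<Longrightarrow> P y \<Longrightarrow> P (x + y)"
  shows "P x"
proof -
  have "P (\<Sum>a\<in>S. Poly_Mapping.single a (Poly_Mapping.lookup x a))" if "finite S" for S
    using that by (induction S) (auto simp: zero single add)
  moreover have "x = (\<Sum>a\<in>Poly_Mapping.keys x. Poly_Mapping.single a (Poly_Mapping.lookup x a))"
    by (rule poly_mapping_eqI)
      (auto simp: lookup_sum lookup_single when_def in_keys_iff)
  ultimately show ?thesis
    by (metis finite_keys)
qed

context witt_datum
begin

lemma phi_simps:
  "\<phi> (d + e) a = \<phi> d a + \<phi> e a" "\<phi> (d - e) a = \<phi> d a - \<phi> e a" "\<phi> (- d) a = - \<phi> d a"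
  "\<phi> 0 a = 0" "\<phi> (scaleT c d) a = c * \<phi> d a"
proof -
  interpret l: Vector_Spaces.linear scaleT "(*)" "\<lambda>d. \<phi> d a" by (rule phi_linear)
  show "\<phi> (d + e) a = \<phi> d a + \<phi> e a" "\<phi> (d - e) a = \<phi> d a - \<phi> e a" "\<phi> (- d) a = - \<phi> d a"
    "\<phi> 0 a = 0" "\<phi> (scaleT c d) a = c * \<phi> d a"
    by (simp_all add: l.add l.diff l.neg l.zero l.scale)
qed

abbreviation monomial_bracket :: "'a \<Rightarrow> 't \<Rightarrow> 'a \<Rightarrow> 't \<Rightarrow> 'a \<Rightarrow>\<^sub>0 't"
  where "monomial_bracket \<alpha> d \<beta> e \<equiv>
    Poly_Mapping.single (\<alpha> + \<beta>) (scaleT (\<phi> d \<beta>) e - scaleT (\<phi> e \<alpha>) d)"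

lemma witt_bracket_superset:
  assumes "finite S" "finite U" "Poly_Mapping.keys x \<subseteq> S" "Poly_Mapping.keys y \<subseteq> U"
  shows "witt_bracket scaleT \<phi> x y =
    (\<Sum>\<alpha>\<in>S. \<Sum>\<beta>\<in>U. monomial_bracket \<alpha> (Poly_Mapping.lookup x \<alpha>) \<beta> (Poly_Mapping.lookup y \<beta>))"
proof -
  have "(\<Sum>\<beta>\<in>Poly_Mapping.keys y.
      monomial_bracket \<alpha> (Poly_Mapping.lookup x \<alpha>) \<beta> (Poly_Mapping.lookup y \<beta>)) =
    (\<Sum>\<beta>\<in>U. monomial_bracket \<alpha> (Poly_Mapping.lookup x \<alpha>) \<beta> (Poly_Mapping.lookup y \<beta>))" for \<alpha>
    by (rule sum.mono_neutral_left) (use assms in \<open>auto simp: in_keys_iff phi_simps\<close>)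
  then show ?thesis
    unfolding witt_bracket_def
    by (simp, intro sum.mono_neutral_left) (use assms in \<open>auto simp: in_keys_iff phi_simps\<close>)
qed

lemma witt_bracket_single:
  "witt_bracket scaleT \<phi> (Poly_Mapping.single \<alpha> d) (Poly_Mapping.single \<beta> e) =
    Poly_Mapping.single (\<alpha> + \<beta>) (scaleT (\<phi> d \<beta>) e - scaleT (\<phi> e \<alpha>) d)"
  by (subst witt_bracket_superset[of "{\<alpha>}" "{\<beta>}"]) auto

lemma witt_bracket_add_left:
  "witt_bracket scaleT \<phi> (x + x') y = witt_bracket scaleT \<phi> x y + witt_bracket scaleT \<phi> x' y"
  using Poly_Mapping.keys_add[of x x']
  by (subst (1 2 3) witt_bracket_superset
        [of "Poly_Mapping.keys x \<union> Poly_Mapping.keys x'" "Poly_Mapping.keys y"])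
    (auto simp: lookup_add phi_simps single_add[symmetric] sum.distrib[symmetric] algebra_simps)

lemma witt_bracket_anti: "witt_bracket scaleT \<phi> y x = - witt_bracket scaleT \<phi> x y"
  unfolding witt_bracket_def
  by (subst sum.swap) (simp add: sum_negf[symmetric] single_uminus[symmetric] add.commute)

lemma witt_bracket_add_right:
  "witt_bracket scaleT \<phi> x (y + y') = witt_bracket scaleT \<phi> x y + witt_bracket scaleT \<phi> x y'"
  by (simp add: witt_bracket_anti[of x] witt_bracket_add_left)

lemma witt_bracket_zero:
  "witt_bracket scaleT \<phi> 0 y = 0" "witt_bracket scaleT \<phi> x 0 = 0"
  by (simp_all add: witt_bracket_def)

lemma lookup_witt_scale:
  "Poly_Mapping.lookup (witt_scale scaleT c x) a = scaleT c (Poly_Mapping.lookup x a)"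
  by (simp add: witt_scale_def map.rep_eq when_def)

lemma witt_scale_single:
  "witt_scale scaleT c (Poly_Mapping.single a d) = Poly_Mapping.single a (scaleT c d)"
  by (rule poly_mapping_eqI) (simp add: lookup_witt_scale lookup_single when_def)

lemma vector_space_witt: "vector_space (witt_scale scaleT)"
  by unfold_locales
    (auto intro!: poly_mapping_eqI simp: lookup_witt_scale lookup_add scale_right_distrib
      scale_left_distrib)

lemma witt_bracket_scale_left:
  "witt_bracket scaleT \<phi> (witt_scale scaleT c x) y = witt_scale scaleT c (witt_bracket scaleT \<phi> x y)"
proof -
  interpret w: vector_space "witt_scale scaleT" by (rule vector_space_witt)
  have mono: "witt_bracket scaleT \<phi> (witt_scale scaleT c (Poly_Mapping.single a d))
      (Poly_Mapping.single b e) =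
    witt_scale scaleT c (witt_bracket scaleT \<phi> (Poly_Mapping.single a d) (Poly_Mapping.single b e))"
    for a b d e
    by (simp add: witt_scale_single witt_bracket_single phi_simps scale_right_diff_distrib
        mult.commute)
  have "witt_bracket scaleT \<phi> (witt_scale scaleT c (Poly_Mapping.single a d)) y =
    witt_scale scaleT c (witt_bracket scaleT \<phi> (Poly_Mapping.single a d) y)" for a d
    by (induction y rule: poly_mapping_additive_induct)
      (simp_all add: mono witt_bracket_add_right witt_bracket_zero w.scale_right_distrib)
  then show ?thesis
    by (induction x rule: poly_mapping_additive_induct)
      (simp_all add: witt_bracket_add_left witt_bracket_zero w.scale_right_distrib)
qed

lemma witt_bracket_alternating: "witt_bracket scaleT \<phi> x x = 0"
proof (induction x rule: poly_mapping_additive_induct)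
  case (3 x y)
  then show ?case
    using witt_bracket_anti[of y x] by (simp add: witt_bracket_add_left witt_bracket_add_right)
qed (simp_all add: witt_bracket_single witt_bracket_zero)

lemma witt_bracket_jacobi:
  "witt_bracket scaleT \<phi> x (witt_bracket scaleT \<phi> y z) +
   witt_bracket scaleT \<phi> y (witt_bracket scaleT \<phi> z x) +
   witt_bracket scaleT \<phi> z (witt_bracket scaleT \<phi> x y) = 0"
proof -
  define J where "J x y z =
   witt_bracket scaleT \<phi> x (witt_bracket scaleT \<phi> y z) +
   witt_bracket scaleT \<phi> y (witt_bracket scaleT \<phi> z x) +
   witt_bracket scaleT \<phi> z (witt_bracket scaleT \<phi> x y)" for x y z
  have add: "J (x + x') y z = J x y z + J x' y z" "J x (y + y') z = J x y z + J x y' z"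
    "J x y (z + z') = J x y z + J x y z'" for x x' y y' z z'
    by (simp_all add: J_def witt_bracket_add_left witt_bracket_add_right algebra_simps)
  have zero: "J 0 y z = 0" "J x 0 z = 0" "J x y 0 = 0" for x y z
    by (simp_all add: J_def witt_bracket_zero)
  have mono: "J (Poly_Mapping.single a d) (Poly_Mapping.single b e) (Poly_Mapping.single c f) = 0"
    for a b c d e f
    by (rule poly_mapping_eqI)
      (simp add: J_def witt_bracket_single lookup_add lookup_single when_def phi_simps phi_add
        scale_right_diff_distrib scale_left_diff_distrib scale_left_distrib algebra_simps)
  have "J (Poly_Mapping.single a d) (Poly_Mapping.single b e) z = 0" for a b d e
    by (induction z rule: poly_mapping_additive_induct) (simp_all add: mono add zero)
  then have "J (Poly_Mapping.single a d) y z = 0" for a d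
    by (induction y rule: poly_mapping_additive_induct) (simp_all add: add zero)
  then have "J x y z = 0"
    by (induction x rule: poly_mapping_additive_induct) (simp_all add: add zero)
  then show ?thesis
    by (simp add: J_def)
qed

theorem lie_algebra_witt: "lie_algebra (witt_scale scaleT) (witt_bracket scaleT \<phi>)"
proof -
  interpret w: vector_space "witt_scale scaleT" by (rule vector_space_witt)
  have right: "witt_bracket scaleT \<phi> x (witt_scale scaleT c y) =
      witt_scale scaleT c (witt_bracket scaleT \<phi> x y)" for c x y
    by (simp add: witt_bracket_anti[of x] witt_bracket_scale_left)
  show ?thesis
    by unfold_locales
      (simp_all add: witt_bracket_add_left witt_bracket_add_right witt_bracket_scale_left right
        witt_bracket_alternating witt_bracket_jacobi)
qed

end

end

theory Submission
  imports Defs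
begin

text \<open>
  The proof rests on knowing all automorphisms of \<open>W = W(A,T,\<phi>)\<close>, and on testing a local
  automorphism on elements generic enough to pin down the automorphism that realises it there.

  Simplicity makes \<open>\<phi>\<close> nondegenerate; in characteristic zero \<open>A\<close> is then torsion free. The torus
  \<open>T = t\<^sup>0T\<close> consists exactly of the elements whose adjoint action is locally finite
  (\<open>ad_locally_finite_iff_torus\<close>): elements of \<open>T\<close> act diagonally, and for any other element the
  leading terms of repeated brackets, for a suitable additive function \<open>A \<rightarrow> \<rat>\<close>, run through
  infinitely many degrees. Hence an automorphism \<open>\<theta>\<close> maps \<open>T\<close> onto \<open>T\<close>, by some \<open>\<tau>\<close>, and permutes the
  weight spaces \<open>t\<^sup>\<alpha>T\<close> of \<open>T\<close>, by some \<open>\<sigma>\<close> with \<open>\<phi>(\<tau>\<partial>,\<sigma>\<alpha>) = \<phi>(\<partial>,\<alpha>)\<close>. After removing \<open>\<sigma>\<close> and \<open>\<tau>\<close>, a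
  computation with brackets (\<open>homogeneous_character\<close>) leaves only a character \<open>\<chi>\<close> of \<open>A\<close>, so that
  \<open>\<theta>(t\<^sup>\<alpha>\<partial>) = \<chi>(\<alpha>) t\<^bsup>\<sigma>\<alpha>\<^esup> \<tau>\<partial>\<close> (\<open>lie_automorphism_form\<close>). Every bijective linear map of this
  form is conversely an automorphism.

  Let \<open>\<Phi>\<close> be a bijective local automorphism and \<open>P\<close> its restriction to \<open>T\<close>. Comparing \<open>\<Phi>\<close> with an
  automorphism at \<open>\<delta> + t\<^sup>\<alpha>\<partial>\<close> gives \<open>\<Phi>(t\<^sup>\<alpha>T) \<subseteq> t\<^bsup>\<sigma>\<alpha>\<^esup>T\<close> with \<open>\<phi>(P\<delta>,\<sigma>\<alpha>) = \<phi>(\<delta>,\<alpha>)\<close> for every \<open>\<delta>\<close>, so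
  \<open>\<sigma>\<close> depends on \<open>P\<close> alone and is additive. For a finite set \<open>S\<close> of nonzero elements of \<open>A\<close> choose \<open>\<delta>\<close>
  with \<open>\<phi>(\<delta>,\<cdot>)\<close> injective on \<open>S\<close> and compare at \<open>\<delta> + \<Sum>\<^sub>s t\<^sup>s\<partial>\<^sub>s\<close>: the degree map of the realising
  automorphism permutes these terms while preserving the values of \<open>\<phi>(\<delta>,\<cdot>)\<close>, so it must agree with
  \<open>\<sigma>\<close> on \<open>S\<close> (\<open>simultaneous_form\<close>). Only finitely many degrees are controlled at a time, but that
  suffices: it shows that \<open>\<Phi>\<close> acts on \<open>t\<^sup>\<alpha>T\<close> as a scalar multiple of \<open>P\<close>, with scalars multiplicative
  in \<open>\<alpha>\<close>. So \<open>\<Phi>\<close> has the form of an automorphism.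
\<close>

section \<open>Separating finitely many points by additive functions\<close>

text \<open>
  A vector space over an infinite field is not a finite union of proper subspaces: here the
  subspaces are those of functions vanishing at one point of \<open>V\<close>.
\<close>

lemma finite_avoidance:
  fixes D :: "('b \<Rightarrow> 'f::field_char_0) set"
  assumes "finite V" and "D \<noteq> {}"
    and closed: "\<And>f g c. f \<in> D \<Longrightarrow> g \<in> D \<Longrightarrow> (\<lambda>x. f x + c * g x) \<in> D"
    and "\<And>v. v \<in> V \<Longrightarrow> \<exists>f\<in>D. f v \<noteq> 0"
  shows "\<exists>f\<in>D. \<forall>v\<in>V. f v \<noteq> 0"
  using assms(1) assms(4)
proof (induction V rule: finite_induct)
  case empty
  then show ?case using \<open>D \<noteq> {}\<close> by auto
next
  case (insert v V)
  then obtain f where f: "f \<in> D" "\<And>w. w \<in> V \<Longrightarrow> f w \<noteq> 0" by blast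
  obtain g where g: "g \<in> D" "g v \<noteq> 0" using insert.prems by blast
  \<comment> \<open>\<open>f + c g\<close> vanishes at a point where \<open>g\<close> does not only for one value of \<open>c\<close>.\<close>
  have "finite ((\<lambda>w. - f w / g w) ` insert v V)" using insert.hyps by simp
  then obtain c where c: "c \<notin> (\<lambda>w. - f w / g w) ` insert v V"
    using ex_new_if_finite infinite_UNIV_char_0 by blast
  have "f w + c * g w \<noteq> 0" if "w \<in> insert v V" for w
  proof
    assume eq: "f w + c * g w = 0"
    show False
    proof (cases "g w = 0")
      case True
      then show False using eq f g that by auto
    next
      case False
      then have "c = - f w / g w" using eq by (simp add: eq_neg_iff_add_eq_0 field_simps)
      then show False using c that by blast
    qed
  qed
  then show ?case using closed[OF f(1) g(1), of c] by (intro bexI) auto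
qed

text \<open>
  A field of characteristic zero need not be ordered, but as a rational vector space it has enough
  rational functionals. They supply the order used for leading terms.
\<close>

lemma additive_rational_functional:
  fixes v :: "'f::field_char_0"
  assumes "v \<noteq> 0"
  obtains f :: "'f \<Rightarrow> rat" where "\<And>x y. f (x + y) = f x + f y" "f v \<noteq> 0"
proof -
  interpret Q: vector_space "\<lambda>(q::rat) (x::'f). of_rat q * x"
    by unfold_locales (simp_all add: algebra_simps of_rat_add of_rat_mult)
  interpret R: vector_space "(*) :: rat \<Rightarrow> rat \<Rightarrow> rat"
    by unfold_locales (simp_all add: algebra_simps)
  interpret QR: vector_space_pair "\<lambda>(q::rat) (x::'f). of_rat q * x" "(*) :: rat \<Rightarrow> rat \<Rightarrow> rat" ..
  have "Q.independent {v}"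
    using assms by (simp add: Q.independent_insert)
  then obtain f where f: "Vector_Spaces.linear (\<lambda>(q::rat) (x::'f). of_rat q * x) (*) f"
      "\<And>x. x \<in> {v} \<Longrightarrow> f x = 1"
    using QR.linear_independent_extend[of "{v}" "\<lambda>_. 1"] by blast
  interpret f: Vector_Spaces.linear "\<lambda>(q::rat) (x::'f). of_rat q * x" "(*)" f by (rule f)
  show ?thesis
    using that[of f] f(2) by (simp add: f.add)
qed

section \<open>Automorphisms and locally finite elements of Lie algebras\<close>

context lie_algebra
begin

definition ad_locally_finite :: "'v \<Rightarrow> bool" where
  "ad_locally_finite x \<longleftrightarrow> (\<forall>y. \<exists>B. finite B \<and> (\<forall>n. (bracket x ^^ n) y \<in> span B))"

lemma lie_automorphism_inv:
  assumes "lie_automorphism scale bracket \<theta>"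
  shows "lie_automorphism scale bracket (inv \<theta>)"
proof -
  interpret l: Vector_Spaces.linear scale scale \<theta>
    using assms by (simp add: lie_automorphism_def)
  have "bij \<theta>" using assms by (simp add: lie_automorphism_def)
  then have inv: "inv \<theta> (\<theta> x) = x" "\<theta> (inv \<theta> x) = x" for x
    by (simp_all add: bij_is_inj bij_is_surj surj_f_inv_f)
  have inv_eq: "inv \<theta> y = x \<longleftrightarrow> y = \<theta> x" for x y
    using inv by auto
  show ?thesis
    unfolding lie_automorphism_def
  proof (intro conjI allI)
    show "bij (inv \<theta>)" using \<open>bij \<theta>\<close> by (rule bij_imp_bij_inv)
    show "Vector_Spaces.linear scale scale (inv \<theta>)"
      by unfold_locales (simp_all add: inv_eq l.add l.scale inv)
    show "inv \<theta> (bracket x y) = bracket (inv \<theta> x) (inv \<theta> y)" for x y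
      using assms by (simp add: inv_eq lie_automorphism_def inv)
  qed
qed

lemma lie_automorphism_ad_locally_finite:
  assumes "lie_automorphism scale bracket \<theta>"
    and lf: "ad_locally_finite x"
  shows "ad_locally_finite (\<theta> x)"
  unfolding ad_locally_finite_def
proof
  fix y
  interpret l: Vector_Spaces.linear scale scale \<theta>
    using assms by (simp add: lie_automorphism_def)
  have "surj \<theta>" using assms by (simp add: lie_automorphism_def bij_is_surj)
  then obtain z where z: "y = \<theta> z" by (rule surjE)
  obtain B where B: "finite B" "\<And>n. (bracket x ^^ n) z \<in> span B"
    using lf unfolding ad_locally_finite_def by blast
  have "(bracket (\<theta> x) ^^ n) y = \<theta> ((bracket x ^^ n) z)" for n
    using assms(1) by (induction n) (simp_all add: z lie_automorphism_def)
  then have "(bracket (\<theta> x) ^^ n) y \<in> span (\<theta> ` B)" for n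
    using B(2) by (simp add: l.span_image)
  then show "\<exists>B. finite B \<and> (\<forall>n. (bracket (\<theta> x) ^^ n) y \<in> span B)"
    using B(1) by blast
qed

end

section \<open>Coefficients of brackets in the generalized Witt algebra\<close>

lemma single_inject: "Poly_Mapping.single a d = Poly_Mapping.single a e \<longleftrightarrow> d = e"
  by (metis lookup_single_eq)

lemma single_eq_0_iff: "Poly_Mapping.single a d = 0 \<longleftrightarrow> d = 0"
  by (metis lookup_single_eq lookup_zero single_zero)

context witt_datum
begin

lemma phi_right_simps:
  "\<phi> d 0 = 0" "\<phi> d (- a) = - \<phi> d a" "\<phi> d (a - b) = \<phi> d a - \<phi> d b"
proof -
  show z: "\<phi> d 0 = 0" using phi_add[of d 0 0] by (metis add.right_neutral add_left_cancel)
  show n: "\<phi> d (- a) = - \<phi> d a" for a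
    using phi_add[of d a "- a"] z by (simp add: eq_neg_iff_add_eq_0 add.commute)
  show "\<phi> d (a - b) = \<phi> d a - \<phi> d b"
    using phi_add[of d a "- b"] n by simp
qed

sublocale W: lie_algebra "witt_scale scaleT" "witt_bracket scaleT \<phi>"
  by (rule lie_algebra_witt)

lemma lookup_bracket:
  "Poly_Mapping.lookup (witt_bracket scaleT \<phi> x y) \<gamma> =
    (\<Sum>\<alpha>\<in>Poly_Mapping.keys x.
      scaleT (\<phi> (Poly_Mapping.lookup x \<alpha>) (\<gamma> - \<alpha>)) (Poly_Mapping.lookup y (\<gamma> - \<alpha>)) -
      scaleT (\<phi> (Poly_Mapping.lookup y (\<gamma> - \<alpha>)) \<alpha>) (Poly_Mapping.lookup x \<alpha>))"
proof -
  have "(\<Sum>\<beta>\<in>Poly_Mapping.keys y. Poly_Mapping.lookup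
      (monomial_bracket \<alpha> (Poly_Mapping.lookup x \<alpha>) \<beta> (Poly_Mapping.lookup y \<beta>)) \<gamma>) =
      scaleT (\<phi> (Poly_Mapping.lookup x \<alpha>) (\<gamma> - \<alpha>)) (Poly_Mapping.lookup y (\<gamma> - \<alpha>)) -
      scaleT (\<phi> (Poly_Mapping.lookup y (\<gamma> - \<alpha>)) \<alpha>) (Poly_Mapping.lookup x \<alpha>)"
    (is "sum ?f _ = ?r") for \<alpha>
  proof -
    have "?f \<beta> = (if \<beta> = \<gamma> - \<alpha> then ?r else 0)" for \<beta>
      by (auto simp: lookup_single when_def algebra_simps)
    then show ?thesis
      by (simp add: in_keys_iff phi_simps)
  qed
  then show ?thesis
    by (simp add: witt_bracket_def lookup_sum)
qed

lemma lookup_bracket_single: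
  "Poly_Mapping.lookup (witt_bracket scaleT \<phi> (Poly_Mapping.single \<alpha> d) y) \<gamma> =
      scaleT (\<phi> d (\<gamma> - \<alpha>)) (Poly_Mapping.lookup y (\<gamma> - \<alpha>)) -
      scaleT (\<phi> (Poly_Mapping.lookup y (\<gamma> - \<alpha>)) \<alpha>) d"
  by (cases "d = 0") (simp_all add: lookup_bracket phi_simps)

text \<open>
  \<open>T\<close> acts diagonally, with the weight \<open>\<phi>(\<cdot>,\<gamma>)\<close> in degree \<open>\<gamma>\<close>.
\<close>

lemma lookup_bracket_torus:
  "Poly_Mapping.lookup (witt_bracket scaleT \<phi> (Poly_Mapping.single 0 d) y) \<gamma> =
      scaleT (\<phi> d \<gamma>) (Poly_Mapping.lookup y \<gamma>)"
  by (simp add: lookup_bracket_single phi_right_simps)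

lemma bracket_torus_single:
  "witt_bracket scaleT \<phi> (Poly_Mapping.single 0 d) (Poly_Mapping.single a e) =
    witt_scale scaleT (\<phi> d a) (Poly_Mapping.single a e)"
  by (simp add: witt_bracket_single witt_scale_single phi_right_simps)

section \<open>Simplicity forces the pairing to be nondegenerate\<close>

text \<open>
  Multiplication by \<open>t\<^sup>a\<close>. If \<open>a\<close> is in the kernel of the pairing, it commutes with all brackets, and
  then \<open>(t\<^sup>a - 1)W\<close> is an ideal.
\<close>

definition shift :: "'a \<Rightarrow> ('a \<Rightarrow>\<^sub>0 't) \<Rightarrow> ('a \<Rightarrow>\<^sub>0 't)" where
  "shift a x = (\<Sum>\<beta>\<in>Poly_Mapping.keys x. Poly_Mapping.single (a + \<beta>) (Poly_Mapping.lookup x \<beta>))"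

lemma lookup_shift:
  "Poly_Mapping.lookup (shift a x) \<gamma> = Poly_Mapping.lookup x (\<gamma> - a)"
proof -
  have "Poly_Mapping.lookup (Poly_Mapping.single (a + \<beta>) (Poly_Mapping.lookup x \<beta>)) \<gamma> =
    (if \<beta> = \<gamma> - a then Poly_Mapping.lookup x \<beta> else 0)" for \<beta>
    by (auto simp: lookup_single when_def algebra_simps)
  then show ?thesis
    by (simp add: shift_def lookup_sum in_keys_iff)
qed

lemma shift_add: "shift a (x + y) = shift a x + shift a y"
  and shift_scale: "shift a (witt_scale scaleT c x) = witt_scale scaleT c (shift a x)"
  by (auto intro!: poly_mapping_eqI simp: lookup_shift lookup_add lookup_witt_scale)

lemma bracket_shift:
  assumes "\<And>d. \<phi> d a = 0"
  shows "witt_bracket scaleT \<phi> x (shift a y) = shift a (witt_bracket scaleT \<phi> x y)"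
proof (rule poly_mapping_eqI)
  fix \<gamma>
  have "\<phi> d (\<gamma> - \<alpha> - a) = \<phi> d (\<gamma> - \<alpha>)" for d \<alpha>
    using assms by (simp add: phi_right_simps)
  then show "Poly_Mapping.lookup (witt_bracket scaleT \<phi> x (shift a y)) \<gamma> =
      Poly_Mapping.lookup (shift a (witt_bracket scaleT \<phi> x y)) \<gamma>"
    by (simp add: lookup_shift lookup_bracket diff_right_commute[of \<gamma> a])
qed

text \<open>
  The augmentation \<open>\<F>A \<otimes> T \<rightarrow> T\<close>, which sends every \<open>t\<^sup>\<alpha>\<close> to \<open>1\<close>. It vanishes on \<open>(t\<^sup>a - 1)W\<close>, which
  shows that this ideal is proper when \<open>T\<close> is nonzero.
\<close>

definition coefficient_sum :: "('a \<Rightarrow>\<^sub>0 't) \<Rightarrow> 't" where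
  "coefficient_sum x = (\<Sum>\<beta>\<in>Poly_Mapping.keys x. Poly_Mapping.lookup x \<beta>)"

lemma coefficient_sum_shift: "coefficient_sum (shift a x) = coefficient_sum x"
proof -
  have keys: "Poly_Mapping.keys (shift a x) = (\<lambda>\<beta>. \<beta> + a) ` Poly_Mapping.keys x"
  proof (rule set_eqI)
    fix \<gamma>
    have "\<gamma> \<in> (\<lambda>\<beta>. \<beta> + a) ` Poly_Mapping.keys x \<longleftrightarrow> \<gamma> - a \<in> Poly_Mapping.keys x"
      by (metis (no_types, lifting) add_diff_cancel diff_add_cancel image_iff)
    then show "\<gamma> \<in> Poly_Mapping.keys (shift a x) \<longleftrightarrow> \<gamma> \<in> (\<lambda>\<beta>. \<beta> + a) ` Poly_Mapping.keys x"
      by (simp add: in_keys_iff lookup_shift)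
  qed
  show ?thesis
    by (simp add: coefficient_sum_def keys sum.reindex lookup_shift)
qed

lemma coefficient_sum_diff: "coefficient_sum (x - y) = coefficient_sum x - coefficient_sum y"
proof -
  let ?K = "Poly_Mapping.keys x \<union> Poly_Mapping.keys y"
  have *: "coefficient_sum z = (\<Sum>\<beta>\<in>?K. Poly_Mapping.lookup z \<beta>)"
    if "Poly_Mapping.keys z \<subseteq> ?K" for z
    unfolding coefficient_sum_def by (rule sum.mono_neutral_left) (use that in \<open>auto simp: in_keys_iff\<close>)
  have "Poly_Mapping.keys (x - y) \<subseteq> ?K"
    by (auto simp: in_keys_iff lookup_minus)
  then show ?thesis
    by (simp add: * lookup_minus sum_subtractf)
qed

text \<open>
  Otherwise \<open>(t\<^sup>a - 1)W\<close> would be an ideal that is neither zero nor everything.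
\<close>

lemma simple_imp_nondegenerate_right:
  assumes "simple_lie_algebra (witt_scale scaleT) (witt_bracket scaleT \<phi>)"
    and "\<And>d. \<phi> d a = 0" and "(d0::'t) \<noteq> 0"
  shows "a = 0"
proof (rule ccontr)
  assume "a \<noteq> 0"
  let ?I = "range (\<lambda>x. shift a x - x)"
  have "lie_ideal (witt_scale scaleT) (witt_bracket scaleT \<phi>) ?I"
    unfolding lie_ideal_def
  proof (intro conjI allI ballI)
    have zero: "0 \<in> ?I" by (rule range_eqI[of _ _ 0]) (simp add: shift_def)
    have sum: "x + y \<in> ?I" if x: "x \<in> ?I" and y: "y \<in> ?I" for x y
    proof -
      obtain x' where x': "x = shift a x' - x'" using x by (rule rangeE)
      obtain y' where y': "y = shift a y' - y'" using y by (rule rangeE)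
      show ?thesis
        by (rule range_eqI[of _ _ "x' + y'"]) (simp add: x' y' shift_add)
    qed
    have scale: "witt_scale scaleT c x \<in> ?I" if x: "x \<in> ?I" for x c
    proof -
      obtain x' where x': "x = shift a x' - x'" using x by (rule rangeE)
      show ?thesis
        by (rule range_eqI[of _ _ "witt_scale scaleT c x'"])
          (simp add: x' shift_scale W.scale_right_diff_distrib)
    qed
    show "W.subspace ?I" using zero sum scale by (rule W.subspaceI)
    fix x y assume "y \<in> ?I"
    then obtain z where z: "y = shift a z - z" by (rule rangeE)
    have bracket_diff: "witt_bracket scaleT \<phi> x (u - v) = witt_bracket scaleT \<phi> x u - witt_bracket scaleT \<phi> x v" for u v
      using witt_bracket_add_right[of x "u - v" v] by simp
    show "witt_bracket scaleT \<phi> x y \<in> ?I"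
      by (rule range_eqI[of _ _ "witt_bracket scaleT \<phi> x z"])
        (simp add: z bracket_diff bracket_shift[OF assms(2)])
  qed
  with assms(1) have "?I = {0} \<or> ?I = UNIV" by (rule simple_lie_algebra.ideal_trivial)
  then show False
  proof
    assume I: "?I = {0}"
    have "shift a (Poly_Mapping.single 0 d0) - Poly_Mapping.single 0 d0 \<in> ?I" by (rule rangeI)
    then have "shift a (Poly_Mapping.single 0 d0) = Poly_Mapping.single 0 d0" unfolding I by simp
    then have "Poly_Mapping.lookup (shift a (Poly_Mapping.single 0 d0)) 0 = d0" by simp
    then show False using \<open>a \<noteq> 0\<close> \<open>d0 \<noteq> 0\<close> by (simp add: lookup_shift lookup_single when_def)
  next
    assume "?I = UNIV"
    then have "Poly_Mapping.single 0 d0 \<in> ?I" by simp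
    then obtain x where "Poly_Mapping.single (0::'a) d0 = shift a x - x" by (rule rangeE)
    then have "coefficient_sum (Poly_Mapping.single (0::'a) d0) = 0"
      by (simp add: coefficient_sum_diff coefficient_sum_shift)
    then show False using \<open>d0 \<noteq> 0\<close> by (simp add: coefficient_sum_def)
  qed
qed

text \<open>
  The elements of \<open>W\<close> with all coefficients in the left kernel of \<open>\<phi>\<close> form an ideal. If it is
  nonzero it is \<open>W\<close>, and then \<open>\<phi>\<close> and the bracket vanish.
\<close>

lemma simple_imp_nondegenerate_left:
  assumes "simple_lie_algebra (witt_scale scaleT) (witt_bracket scaleT \<phi>)"
    and rad: "\<And>a. \<phi> d a = 0"
  shows "d = 0"
proof (rule ccontr)
  assume "d \<noteq> 0"
  let ?I = "{x :: 'a \<Rightarrow>\<^sub>0 't. \<forall>\<beta> a. \<phi> (Poly_Mapping.lookup x \<beta>) a = 0}"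
  have sum: "\<phi> (sum g X) a = (\<Sum>i\<in>X. \<phi> (g i) a)" for g X a
    by (induction X rule: infinite_finite_induct) (simp_all add: phi_simps)
  have "lie_ideal (witt_scale scaleT) (witt_bracket scaleT \<phi>) ?I"
    unfolding lie_ideal_def W.subspace_def
    by (auto simp: lookup_add phi_simps lookup_witt_scale lookup_bracket sum)
  with assms(1) have trivial: "?I = {0} \<or> ?I = UNIV" by (rule simple_lie_algebra.ideal_trivial)
  have mem: "Poly_Mapping.single 0 d \<in> ?I"
    using rad by (simp add: lookup_single when_def phi_simps)
  have "Poly_Mapping.single (0::'a) d \<noteq> 0"
    using \<open>d \<noteq> 0\<close> by (metis lookup_single_eq lookup_zero)
  with mem have "?I \<noteq> {0}" by (metis singletonD)
  with trivial have I: "?I = UNIV" by blast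
  have "\<phi> e b = 0" for e b
  proof -
    have "Poly_Mapping.single 0 e \<in> ?I" unfolding I by simp
    then have "\<phi> (Poly_Mapping.lookup (Poly_Mapping.single (0::'a) e) 0) b = 0" by blast
    then show ?thesis by simp
  qed
  then have "witt_bracket scaleT \<phi> x y = 0" for x y
    by (simp add: witt_bracket_def)
  then show False using simple_lie_algebra.nonabelian[OF assms(1)] by blast
qed

lemma simple_imp_nontrivial:
  assumes "simple_lie_algebra (witt_scale scaleT) (witt_bracket scaleT \<phi>)"
  shows "\<exists>d::'t. d \<noteq> 0"
proof (rule ccontr)
  assume "\<nexists>d::'t. d \<noteq> 0"
  then have "x = y" for x y :: "'a \<Rightarrow>\<^sub>0 't" by (metis poly_mapping_eqI)
  then show False using simple_lie_algebra.nonabelian[OF assms] by blast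
qed

end

locale nondegenerate_witt_datum = witt_datum scaleT \<phi>
  for scaleT :: "'k::field_char_0 \<Rightarrow> 't::ab_group_add \<Rightarrow> 't"
    and \<phi> :: "'t \<Rightarrow> 'a::ab_group_add \<Rightarrow> 'k" +
  assumes nondegenerate_right: "(\<And>d. \<phi> d a = 0) \<Longrightarrow> a = 0"
    and nondegenerate_left: "(\<And>a. \<phi> d a = 0) \<Longrightarrow> d = 0"
    and nontrivial: "\<exists>d::'t. d \<noteq> 0"

context nondegenerate_witt_datum
begin

lemma dual_vector:
  assumes "a \<noteq> 0" obtains d where "\<phi> d a = 1"
proof -
  obtain e where e: "\<phi> e a \<noteq> 0" using nondegenerate_right assms by blast
  then show ?thesis using that[of "scaleT (inverse (\<phi> e a)) e"] by (simp add: phi_simps)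
qed

text \<open>
  The differences of distinct elements of \<open>S\<close> are finitely many nonzero points, which a single \<open>d\<close>
  avoids killing.
\<close>

lemma separating_vector:
  assumes "finite S"
  obtains d where "inj_on (\<phi> d) S"
proof -
  let ?V = "(\<lambda>(s, s'). s - s') ` (S \<times> S) - {0}"
  have "\<exists>f\<in>range \<phi>. \<forall>v\<in>?V. f v \<noteq> 0"
  proof (rule finite_avoidance)
    show "finite ?V" using assms by simp
    show "(\<lambda>x. f x + c * g x) \<in> range \<phi>" if "f \<in> range \<phi>" "g \<in> range \<phi>" for f g c
    proof -
      obtain d e where "f = \<phi> d" "g = \<phi> e" using \<open>f \<in> range \<phi>\<close> \<open>g \<in> range \<phi>\<close> by auto
      then have "(\<lambda>x. f x + c * g x) = \<phi> (d + scaleT c e)" by (auto simp: phi_simps)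
      then show ?thesis by blast
    qed
    show "\<exists>f\<in>range \<phi>. f v \<noteq> 0" if "v \<in> ?V" for v
      using that nondegenerate_right by blast
  qed auto
  then obtain d where d: "\<forall>v\<in>?V. \<phi> d v \<noteq> 0" by blast
  have "inj_on (\<phi> d) S"
  proof (rule inj_onI, rule ccontr)
    fix s s' assume "s \<in> S" "s' \<in> S" "\<phi> d s = \<phi> d s'" "s \<noteq> s'"
    then have "s - s' \<in> ?V" "\<phi> d (s - s') = 0" by (auto simp: phi_right_simps)
    then show False using d by blast
  qed
  then show ?thesis by (rule that)
qed

lemma separating_rational_functional:
  assumes "finite S"
  obtains g :: "'a \<Rightarrow> rat" where "\<And>a b. g (a + b) = g a + g b" "inj_on g S"
proof -
  let ?V = "(\<lambda>(s, s'). s - s') ` (S \<times> S) - {0}"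
  let ?D = "{g :: 'a \<Rightarrow> rat. \<forall>a b. g (a + b) = g a + g b}"
  have "\<exists>f\<in>?D. \<forall>v\<in>?V. f v \<noteq> 0"
  proof (rule finite_avoidance)
    show "finite ?V" using assms by simp
    have "(\<lambda>_. 0) \<in> ?D" by simp
    then show "?D \<noteq> {}" by (metis empty_iff)
    show "(\<lambda>x. f x + c * g x) \<in> ?D" if "f \<in> ?D" "g \<in> ?D" for f g c
      using that by (auto simp: algebra_simps)
    show "\<exists>f\<in>?D. f v \<noteq> 0" if v: "v \<in> ?V" for v
    proof -
      obtain d where "\<phi> d v \<noteq> 0" using v nondegenerate_right by blast
      then obtain h :: "'k \<Rightarrow> rat" where "\<And>x y. h (x + y) = h x + h y" "h (\<phi> d v) \<noteq> 0"
        using additive_rational_functional by metis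
      then show ?thesis by (intro bexI[of _ "\<lambda>a. h (\<phi> d a)"]) (auto simp: phi_add)
    qed
  qed
  then obtain g :: "'a \<Rightarrow> rat" where g: "\<forall>v\<in>?V. g v \<noteq> 0" "\<And>a b. g (a + b) = g a + g b" by blast
  have "inj_on g S"
  proof (rule inj_onI, rule ccontr)
    fix s s' assume "s \<in> S" "s' \<in> S" "g s = g s'" "s \<noteq> s'"
    then have "s - s' \<in> ?V" by auto
    moreover have "g (s - s') = 0" using g(2)[of "s - s'" s'] \<open>g s = g s'\<close> by simp
    ultimately show False using g(1) by blast
  qed
  then show ?thesis by (rule that[OF g(2)])
qed

section \<open>The locally finite elements form the torus\<close>

lemma torus_ad_locally_finite: "W.ad_locally_finite (Poly_Mapping.single 0 d)"
  unfolding W.ad_locally_finite_def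
proof
  fix y :: "'a \<Rightarrow>\<^sub>0 't"
  let ?B = "(\<lambda>\<gamma>. Poly_Mapping.single \<gamma> (Poly_Mapping.lookup y \<gamma>)) ` Poly_Mapping.keys y"
  have lookup: "Poly_Mapping.lookup ((witt_bracket scaleT \<phi> (Poly_Mapping.single 0 d) ^^ n) y) \<gamma> =
      scaleT (\<phi> d \<gamma> ^ n) (Poly_Mapping.lookup y \<gamma>)" for n \<gamma>
    by (induction n) (simp_all add: lookup_bracket_torus)
  have "(witt_bracket scaleT \<phi> (Poly_Mapping.single 0 d) ^^ n) y \<in> W.span ?B" for n
  proof -
    have "(witt_bracket scaleT \<phi> (Poly_Mapping.single 0 d) ^^ n) y =
      (\<Sum>\<gamma>\<in>Poly_Mapping.keys y.
        witt_scale scaleT (\<phi> d \<gamma> ^ n) (Poly_Mapping.single \<gamma> (Poly_Mapping.lookup y \<gamma>)))"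
      by (rule poly_mapping_eqI)
        (auto simp: lookup lookup_sum witt_scale_single lookup_single when_def in_keys_iff)
    also have "\<dots> \<in> W.span ?B"
      by (intro W.span_sum W.span_scale W.span_base) auto
    finally show ?thesis .
  qed
  then show "\<exists>B. finite B \<and> (\<forall>n. (witt_bracket scaleT \<phi> (Poly_Mapping.single 0 d) ^^ n) y \<in> W.span B)"
    by (intro exI[of _ ?B]) auto
qed

text \<open>
  Consequently a finite-dimensional subspace of \<open>W\<close> lives in finitely many degrees.
\<close>

lemma keys_span:
  assumes "z \<in> W.span B"
  shows "Poly_Mapping.keys z \<subseteq> (\<Union>b\<in>B. Poly_Mapping.keys b)"
  using assms
proof (induction rule: W.span_induct_alt)
  case base
  then show ?case by simp
next
  case (step c b z)
  show ?case
  proof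
    fix \<gamma> assume "\<gamma> \<in> Poly_Mapping.keys (witt_scale scaleT c b + z)"
    then have "\<gamma> \<in> Poly_Mapping.keys b \<or> \<gamma> \<in> Poly_Mapping.keys z"
      by (auto simp: in_keys_iff lookup_add lookup_witt_scale)
    then show "\<gamma> \<in> (\<Union>b\<in>B. Poly_Mapping.keys b)" using step by blast
  qed
qed

text \<open>
  If \<open>t\<^sup>\<alpha>\<partial>\<close> is the leading term of \<open>x\<close> with respect to \<open>g\<close>, then only this term of \<open>x\<close> contributes to
  the bracket in degree \<open>\<alpha> + \<beta>\<close>, where \<open>g \<beta>\<close> bounds the degrees of \<open>y\<close>.
\<close>

lemma leading_term:
  fixes g :: "'a \<Rightarrow> rat"
  assumes add: "\<And>a b. g (a + b) = g a + g b"
    and \<alpha>: "\<alpha> \<in> Poly_Mapping.keys x" "\<And>\<alpha>'. \<alpha>' \<in> Poly_Mapping.keys x \<Longrightarrow> \<alpha>' \<noteq> \<alpha> \<Longrightarrow> g \<alpha>' < g \<alpha>"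
    and y: "\<And>\<gamma>. g \<beta> < g \<gamma> \<Longrightarrow> Poly_Mapping.lookup y \<gamma> = 0"
  shows "g (\<alpha> + \<beta>) < g \<gamma> \<Longrightarrow> Poly_Mapping.lookup (witt_bracket scaleT \<phi> x y) \<gamma> = 0"
    and "Poly_Mapping.lookup (witt_bracket scaleT \<phi> x y) (\<alpha> + \<beta>) =
      scaleT (\<phi> (Poly_Mapping.lookup x \<alpha>) \<beta>) (Poly_Mapping.lookup y \<beta>) -
      scaleT (\<phi> (Poly_Mapping.lookup y \<beta>) \<alpha>) (Poly_Mapping.lookup x \<alpha>)"
proof -
  have diff: "g (a - b) = g a - g b" for a b using add[of "a - b" b] by simp
  show "Poly_Mapping.lookup (witt_bracket scaleT \<phi> x y) \<gamma> = 0" if "g (\<alpha> + \<beta>) < g \<gamma>"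
  proof -
    have "Poly_Mapping.lookup y (\<gamma> - \<alpha>') = 0" if "\<alpha>' \<in> Poly_Mapping.keys x" for \<alpha>'
    proof -
      have "g \<alpha>' \<le> g \<alpha>" using \<alpha>(2)[OF that] by (cases "\<alpha>' = \<alpha>") auto
      then show ?thesis using \<open>g (\<alpha> + \<beta>) < g \<gamma>\<close> by (intro y) (simp add: diff add)
    qed
    then show ?thesis by (simp add: lookup_bracket phi_simps)
  qed
  have "Poly_Mapping.lookup y (\<alpha> + \<beta> - \<alpha>') = 0" if "\<alpha>' \<in> Poly_Mapping.keys x - {\<alpha>}" for \<alpha>'
    using \<alpha>(2)[of \<alpha>'] that by (intro y) (auto simp: diff add)
  then show "Poly_Mapping.lookup (witt_bracket scaleT \<phi> x y) (\<alpha> + \<beta>) =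
      scaleT (\<phi> (Poly_Mapping.lookup x \<alpha>) \<beta>) (Poly_Mapping.lookup y \<beta>) -
      scaleT (\<phi> (Poly_Mapping.lookup y \<beta>) \<alpha>) (Poly_Mapping.lookup x \<alpha>)"
    by (simp add: lookup_bracket sum.remove[OF finite_keys \<alpha>(1)] phi_simps)
qed

text \<open>
  Starting from \<open>t\<^sup>\<beta>\<partial>\<close>, where \<open>t\<^sup>\<alpha>\<partial>\<close> is the leading term of \<open>x\<close>, the coefficient of the \<open>n\<close>-th iterate
  in the top degree \<open>n\<alpha> + \<beta>\<close> is a multiple of \<open>\<partial>\<close>: the bracket of \<open>t\<^sup>\<alpha>\<partial>\<close> with \<open>t\<^sup>\<gamma>\<partial>\<close> is
  \<open>\<phi>(\<partial>,\<gamma> - \<alpha>) t\<^bsup>\<alpha>+\<gamma>\<^esup>\<partial>\<close>. With \<open>\<beta>\<close> chosen so that these factors never vanish, the iterates involve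
  infinitely many degrees.
\<close>

lemma not_ad_locally_finite:
  fixes g :: "'a \<Rightarrow> rat"
  assumes add: "\<And>a b. g (a + b) = g a + g b"
    and \<alpha>: "\<alpha> \<in> Poly_Mapping.keys x" "\<And>\<alpha>'. \<alpha>' \<in> Poly_Mapping.keys x \<Longrightarrow> \<alpha>' \<noteq> \<alpha> \<Longrightarrow> g \<alpha>' < g \<alpha>"
    and pos: "0 < g \<alpha>"
  shows "\<not> W.ad_locally_finite x"
proof
  assume lf: "W.ad_locally_finite x"
  define d where "d = Poly_Mapping.lookup x \<alpha>"
  have "d \<noteq> 0" using \<alpha>(1) by (simp add: d_def in_keys_iff)
  \<comment> \<open>The \<open>n\<close>-th factor is \<open>\<phi> d (\<beta> + n\<alpha> - \<alpha>)\<close>. If \<open>\<phi> d \<alpha> \<noteq> 0\<close>, then \<open>\<beta> = 2\<alpha>\<close> makes it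
    \<open>(n + 1) \<phi> d \<alpha>\<close>, which is nonzero in characteristic zero.\<close>
  obtain \<beta> where \<beta>: "\<phi> d \<beta> + (of_nat n - 1) * \<phi> d \<alpha> \<noteq> 0" for n
  proof (cases "\<phi> d \<alpha> = 0")
    case True
    obtain \<beta> where "\<phi> d \<beta> \<noteq> 0" using nondegenerate_left \<open>d \<noteq> 0\<close> by blast
    then show ?thesis using that[of \<beta>] True by simp
  next
    case False
    have "\<phi> d (\<alpha> + \<alpha>) + (of_nat n - 1) * \<phi> d \<alpha> = of_nat (Suc n) * \<phi> d \<alpha>" for n
      by (simp add: phi_add algebra_simps)
    then show ?thesis using that[of "\<alpha> + \<alpha>"] False by (metis mult_eq_0_iff of_nat_neq_0)
  qed
  define b where "b n = ((+) \<alpha> ^^ n) \<beta>" for n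
  have b: "b 0 = \<beta>" "b (Suc n) = \<alpha> + b n" for n by (simp_all add: b_def)
  have phi_b: "\<phi> d (b n) = \<phi> d \<beta> + of_nat n * \<phi> d \<alpha>" for n
    by (induction n) (simp_all add: b phi_add algebra_simps)
  have g_b: "g (b n) = g \<beta> + of_nat n * g \<alpha>" for n
    by (induction n) (simp_all add: b add algebra_simps)
  let ?y = "\<lambda>n. (witt_bracket scaleT \<phi> x ^^ n) (Poly_Mapping.single \<beta> d)"
  have "(\<forall>\<gamma>. g (b n) < g \<gamma> \<longrightarrow> Poly_Mapping.lookup (?y n) \<gamma> = 0) \<and>
      (\<exists>s. s \<noteq> 0 \<and> Poly_Mapping.lookup (?y n) (b n) = scaleT s d)" for n
  proof (induction n)
    case 0
    show ?case by (auto simp: b lookup_single when_def intro!: exI[of _ 1])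
  next
    case (Suc n)
    then obtain s where s: "s \<noteq> 0" "Poly_Mapping.lookup (?y n) (b n) = scaleT s d" by blast
    have above: "g (b n) < g \<gamma> \<Longrightarrow> Poly_Mapping.lookup (?y n) \<gamma> = 0" for \<gamma> using Suc by blast
    note lt = leading_term[where g = g and x = x and \<alpha> = \<alpha> and y = "?y n" and \<beta> = "b n", OF add \<alpha> above]
    have "Poly_Mapping.lookup (?y (Suc n)) (b (Suc n)) =
        scaleT (s * (\<phi> d \<beta> + (of_nat n - 1) * \<phi> d \<alpha>)) d"
      using lt(2) s(2)
      by (simp add: b phi_b phi_simps d_def[symmetric] scale_left_diff_distrib[symmetric] algebra_simps)
    moreover have "s * (\<phi> d \<beta> + (of_nat n - 1) * \<phi> d \<alpha>) \<noteq> 0" using s(1) \<beta> by simp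
    moreover have "Poly_Mapping.lookup (?y (Suc n)) \<gamma> = 0" if "g (b (Suc n)) < g \<gamma>" for \<gamma>
      using lt(1) that by (simp add: b)
    ultimately show ?case by blast
  qed
  then have keys: "b n \<in> Poly_Mapping.keys (?y n)" for n
    using \<open>d \<noteq> 0\<close> by (metis in_keys_iff scale_eq_0_iff)
  obtain B where B: "finite B" "\<And>n. ?y n \<in> W.span B"
    using lf unfolding W.ad_locally_finite_def by blast
  have "range b \<subseteq> (\<Union>z\<in>B. Poly_Mapping.keys z)"
    using keys keys_span[OF B(2)] by blast
  then have "finite (range b)" using B(1) by (meson finite_UN_I finite_keys finite_subset)
  moreover have "inj b"
  proof (rule injI)
    fix m n assume "b m = b n"
    then have "g (b m) = g (b n)" by simp
    then show "m = n" using pos by (simp add: g_b)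
  qed
  ultimately show False using finite_imageD by blast
qed

text \<open>
  This describes the torus in terms of the bracket alone, so that automorphisms must preserve it. If \<open>x\<close>
  has a nonzero degree, then \<open>g\<close> or \<open>-g\<close> is positive on its leading term, where \<open>g\<close> separates the
  degrees of \<open>x\<close> from each other and from \<open>0\<close>.
\<close>

lemma ad_locally_finite_iff_torus:
  "W.ad_locally_finite x \<longleftrightarrow> (\<exists>d. x = Poly_Mapping.single 0 d)"
proof
  assume lf: "W.ad_locally_finite x"
  obtain g :: "'a \<Rightarrow> rat" where add: "\<And>a b. g (a + b) = g a + g b"
    and inj: "inj_on g (insert 0 (Poly_Mapping.keys x))"
    by (rule separating_rational_functional[of "insert 0 (Poly_Mapping.keys x)"]) auto
  have nonpos: "h \<alpha> \<le> 0" if h: "\<And>a b. h (a + b) = h a + h b" "inj_on h (insert 0 (Poly_Mapping.keys x))"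
      and "\<alpha> \<in> Poly_Mapping.keys x" for h :: "'a \<Rightarrow> rat" and \<alpha>
  proof (rule ccontr)
    assume "\<not> h \<alpha> \<le> 0"
    let ?M = "Max (h ` Poly_Mapping.keys x)"
    have "?M \<in> h ` Poly_Mapping.keys x" using \<open>\<alpha> \<in> _\<close> by (intro Max_in) auto
    then obtain \<mu> where \<mu>: "\<mu> \<in> Poly_Mapping.keys x" "h \<mu> = ?M" by auto
    have max: "h \<nu> \<le> h \<mu>" if "\<nu> \<in> Poly_Mapping.keys x" for \<nu>
      using that \<mu>(2) by simp
    have "h \<nu> < h \<mu>" if "\<nu> \<in> Poly_Mapping.keys x" "\<nu> \<noteq> \<mu>" for \<nu>
      using max[OF that(1)] inj_onD[OF h(2), of \<nu> \<mu>] that \<mu>(1) by (auto simp: less_le)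
    moreover have "0 < h \<mu>" using max[OF \<open>\<alpha> \<in> _\<close>] \<open>\<not> h \<alpha> \<le> 0\<close> by simp
    ultimately show False using not_ad_locally_finite[OF h(1) \<mu>(1)] lf by blast
  qed
  have g0: "g 0 = 0" using add[of 0 0] by simp
  have "\<alpha> = 0" if "\<alpha> \<in> Poly_Mapping.keys x" for \<alpha>
  proof -
    have "g \<alpha> \<le> 0" using nonpos[OF add inj that] .
    moreover have "- g \<alpha> \<le> 0"
      by (rule nonpos[of "\<lambda>a. - g a", OF _ _ that]) (use inj in \<open>auto simp: add inj_on_def\<close>)
    ultimately have "g \<alpha> = g 0" using g0 by simp
    then show ?thesis using inj_onD[OF inj, of \<alpha> 0] that by simp
  qed
  then have "x = Poly_Mapping.single 0 (Poly_Mapping.lookup x 0)"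
    by (intro poly_mapping_eqI) (auto simp: lookup_single when_def in_keys_iff)
  then show "\<exists>d. x = Poly_Mapping.single 0 d" by blast
qed (auto simp: torus_ad_locally_finite)

lemma lie_automorphism_torus_iff:
  assumes "lie_automorphism (witt_scale scaleT) (witt_bracket scaleT \<phi>) \<theta>"
  shows "(\<exists>e. \<theta> x = Poly_Mapping.single 0 e) \<longleftrightarrow> (\<exists>d. x = Poly_Mapping.single 0 d)"
proof -
  have "inv \<theta> (\<theta> x) = x" using assms by (simp add: lie_automorphism_def bij_is_inj)
  then have "W.ad_locally_finite (\<theta> x) \<longleftrightarrow> W.ad_locally_finite x"
    using W.lie_automorphism_ad_locally_finite[OF assms, of x]
      W.lie_automorphism_ad_locally_finite[OF W.lie_automorphism_inv[OF assms], of "\<theta> x"] by auto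
  then show ?thesis by (simp only: ad_locally_finite_iff_torus)
qed

text \<open>
  This applies to automorphisms and to bijective local automorphisms alike: for the latter the
  hypothesis on \<open>F\<close> can be checked one element at a time.
\<close>

lemma restrict_to_torus:
  fixes F :: "('a \<Rightarrow>\<^sub>0 't) \<Rightarrow> ('a \<Rightarrow>\<^sub>0 't)"
  assumes lin: "Vector_Spaces.linear (witt_scale scaleT) (witt_scale scaleT) F" and "bij F"
    and torus: "\<And>x. (\<exists>e. F x = Poly_Mapping.single 0 e) \<longleftrightarrow> (\<exists>d. x = Poly_Mapping.single 0 d)"
  obtains P where "\<And>d. F (Poly_Mapping.single 0 d) = Poly_Mapping.single 0 (P d)"
    "Vector_Spaces.linear scaleT scaleT P" "bij P"
proof -
  interpret l: Vector_Spaces.linear "witt_scale scaleT" "witt_scale scaleT" F by (rule lin)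
  have "\<exists>e. F (Poly_Mapping.single 0 d) = Poly_Mapping.single 0 e" for d
    using torus by blast
  then obtain P where P: "\<And>d. F (Poly_Mapping.single 0 d) = Poly_Mapping.single 0 (P d)"
    by metis
  have single_eq: "d = e" if "Poly_Mapping.single (0::'a) d = Poly_Mapping.single 0 e" for d e :: 't
    using that by (metis lookup_single_eq)
  show ?thesis
  proof (rule that[OF P])
    show "Vector_Spaces.linear scaleT scaleT P"
    proof unfold_locales
      show "P (d + e) = P d + P e" for d e
        by (rule single_eq) (simp add: P[symmetric] single_add l.add)
      show "P (scaleT c d) = scaleT c (P d)" for c d
        by (rule single_eq) (simp add: P[symmetric] witt_scale_single[symmetric] l.scale)
    qed
    show "bij P"
    proof (rule bijI)
      show "inj P"
      proof (rule injI)
        fix d e assume "P d = P e"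
        then have "F (Poly_Mapping.single 0 d) = F (Poly_Mapping.single 0 e)" by (simp add: P)
        then show "d = e" using \<open>bij F\<close> by (intro single_eq) (simp add: bij_is_inj inj_eq)
      qed
      show "surj P"
        unfolding surj_def
      proof
        fix e
        obtain x where x: "F x = Poly_Mapping.single 0 e" using \<open>bij F\<close> by (metis bij_pointE)
        then obtain d where "x = Poly_Mapping.single 0 d" using torus by blast
        then have "e = P d" using x by (intro single_eq) (simp add: P)
        then show "\<exists>d. e = P d" by blast
      qed
    qed
  qed
qed

section \<open>Rigidity of homogeneous automorphisms\<close>

text \<open>
  The map \<open>t\<^sup>\<alpha>\<partial> \<mapsto> t\<^sup>\<alpha> f\<^sub>\<alpha>\<partial>\<close> preserves brackets and fixes \<open>T\<close>. Bracketing degree \<open>a\<close> with degree \<open>-a\<close>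
  shows that \<open>f\<^sub>a\<close> is multiplication by some \<open>c\<close> on the kernel of \<open>\<phi>(\<cdot>,a)\<close>, and that \<open>f\<^sub>a e\<^sub>0 = c e\<^sub>0 + k\<close>
  with \<open>\<phi>(k,a) = 0\<close>, where \<open>\<phi>(e\<^sub>0,a) = 1\<close>.
  
  The point is that \<open>k = 0\<close>. If \<open>\<phi>(k,b) \<noteq> 0\<close>, move \<open>e\<^sub>0\<close> along \<open>k\<close> to a vector \<open>d\<close> with \<open>\<phi>(d,a) = 1\<close> and
  \<open>\<phi>(d,b) = 0\<close>. Then \<open>t\<^sup>a d\<close> commutes with \<open>t\<^sup>b k\<close>, and so does \<open>t\<^bsup>-a\<^esup> d\<close>. For \<open>v = f\<^sub>b k\<close> the images of these
  two relations force \<open>\<phi>(v,b) = \<phi>(v,a)\<close> and \<open>\<phi>(v,b) = -\<phi>(v,a)\<close>, although \<open>\<phi>(v,b) \<noteq> 0\<close>.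
\<close>

lemma homogeneous_scalar:
  assumes lin: "\<And>a. Vector_Spaces.linear scaleT scaleT (f a)"
    and f0: "\<And>d. f 0 d = d"
    and bracket: "\<And>a b d e. f (a + b) (scaleT (\<phi> d b) e - scaleT (\<phi> e a) d) =
      scaleT (\<phi> (f a d) b) (f b e) - scaleT (\<phi> (f b e) a) (f a d)"
    and "a \<noteq> 0"
  shows "\<exists>c. \<forall>d. f a d = scaleT c d"
proof -
  have f_add: "f a (d + e) = f a d + f a e" and f_diff: "f a (d - e) = f a d - f a e"
    and f_scale: "f a (scaleT c d) = scaleT c (f a d)" and f_zero: "f a 0 = 0" for a c d e
  proof -
    interpret l: Vector_Spaces.linear scaleT scaleT "f a" by (rule lin)
    show "f a (d + e) = f a d + f a e" "f a (d - e) = f a d - f a e"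
      "f a (scaleT c d) = scaleT c (f a d)" "f a 0 = 0"
      by (simp_all add: l.add l.diff l.scale l.zero)
  qed
  have opposite: "scaleT (\<phi> d a) e + scaleT (\<phi> e a) d =
      scaleT (\<phi> (f a d) a) (f (- a) e) + scaleT (\<phi> (f (- a) e) a) (f a d)" for a d e
  proof -
    have "- (scaleT (\<phi> d a) e + scaleT (\<phi> e a) d) =
      - (scaleT (\<phi> (f a d) a) (f (- a) e) + scaleT (\<phi> (f (- a) e) a) (f a d))"
      using bracket[of a "- a" d e] by (simp add: f0 phi_right_simps scale_minus_left)
    then show ?thesis by (simp only: neg_equal_iff_equal)
  qed
  have product: "\<phi> d a * \<phi> e a = \<phi> (f a d) a * \<phi> (f (- a) e) a" for a d e
    using arg_cong[OF opposite[of d a e], of "\<lambda>v. \<phi> v a"] by (simp add: phi_simps mult.commute)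
  obtain e0 where e0: "\<phi> e0 a = 1" using \<open>a \<noteq> 0\<close> by (rule dual_vector)
  define c where "c = \<phi> (f a e0) a"
  define c' where "c' = \<phi> (f (- a) e0) a"
  have cc': "c * c' = 1" using product[of e0 a e0] by (simp add: c_def c'_def e0)
  have phi_f: "\<phi> (f a d) a = c * \<phi> d a" for d
  proof -
    have "\<phi> (f a d) a * c' = \<phi> d a" using product[of d a e0] by (simp add: c'_def e0)
    with cc' show ?thesis by algebra
  qed
  have phi_f': "\<phi> (f (- a) d) a = c' * \<phi> d a" for d
  proof -
    have "\<phi> d a = c * \<phi> (f (- a) d) a" using product[of e0 a d] by (simp add: c_def e0)
    with cc' show ?thesis by algebra
  qed
  have kernel: "f a d = scaleT c d" if "\<phi> d a = 0" for d
  proof -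
    have "d = scaleT c' (f a d)" using opposite[of d a e0] that by (simp add: e0 phi_f phi_f')
    then have "scaleT c d = scaleT (c * c') (f a d)" by (metis scale_scale)
    then show ?thesis by (simp add: cc')
  qed
  define k where "k = f a e0 - scaleT c e0"
  have k_a: "\<phi> k a = 0" by (simp add: k_def phi_simps phi_f e0)
  have "\<phi> k b = 0" for b
  proof (rule ccontr)
    assume k_b: "\<phi> k b \<noteq> 0"
    define d where "d = e0 - scaleT (\<phi> e0 b / \<phi> k b) k"
    have d_a: "\<phi> d a = 1" by (simp add: d_def phi_simps e0 k_a)
    have d_b: "\<phi> d b = 0" using k_b by (simp add: d_def phi_simps)
    have "f a e0 = k + scaleT c e0" by (simp add: k_def)
    then have "f a d = scaleT c d + k"
      by (simp add: d_def f_diff f_scale kernel[OF k_a] scale_right_diff_distrib algebra_simps)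
    then have fd_b: "\<phi> (f a d) b = \<phi> k b" by (simp add: phi_simps d_b)
    have "\<phi> (f (- a) d) b \<noteq> 0"
    proof
      assume z: "\<phi> (f (- a) d) b = 0"
      have "c' * \<phi> (f a d) b = 0"
        using arg_cong[OF opposite[of d a d], of "\<lambda>v. \<phi> v b"]
        by (simp add: phi_simps d_a d_b phi_f phi_f' z)
      then show False using cc' k_b fd_b by auto
    qed
    moreover define v where "v = f b k"
    have "\<phi> v b \<noteq> 0"
      using product[of k b k] k_b by (auto simp: v_def)
    ultimately have nz: "\<phi> v b \<noteq> 0" "\<phi> (f (- a) d) b \<noteq> 0" by auto
    \<comment> \<open>The image of \<open>[t\<^sup>a d, t\<^sup>b k] = 0\<close>, and further below that of \<open>[t\<^bsup>-a\<^esup> d, t\<^sup>b k] = 0\<close>.\<close>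
    have "scaleT (\<phi> (f a d) b) v = scaleT (\<phi> v a) (f a d)"
      using bracket[of a b d k] by (simp add: d_b k_a f_zero v_def)
    from arg_cong[OF this, of "\<lambda>v. \<phi> v b"] have "\<phi> v b = \<phi> v a"
      using k_b by (simp add: phi_simps fd_b)
    moreover have "scaleT (\<phi> (f (- a) d) b) v = scaleT (- \<phi> v a) (f (- a) d)"
      using bracket[of "- a" b d k] by (simp add: d_b k_a f_zero v_def phi_right_simps eq_neg_iff_add_eq_0)
    from arg_cong[OF this, of "\<lambda>v. \<phi> v b"]
    have "\<phi> (f (- a) d) b * \<phi> v b = \<phi> (f (- a) d) b * (- \<phi> v a)"
      by (simp add: phi_simps)
    then have "\<phi> v b = - \<phi> v a" using nz(2) by (simp only: mult_cancel_left simp_thms)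
    ultimately show False using nz(1) by simp
  qed
  then have "k = 0" by (rule nondegenerate_left)
  then have e0_eigen: "f a e0 = scaleT c e0" by (simp add: k_def)
  have "f a d = scaleT c d" for d
  proof -
    have "\<phi> (d - scaleT (\<phi> d a) e0) a = 0" by (simp add: phi_simps e0)
    from kernel[OF this] show ?thesis
      by (simp add: f_diff f_scale e0_eigen scale_right_diff_distrib mult.commute)
  qed
  then show ?thesis by blast
qed

lemma multiple_nonzero:
  assumes "(a::'a) \<noteq> 0" shows "a + a \<noteq> 0" "a + (a + a) \<noteq> 0"
proof -
  obtain d where d: "\<phi> d a = 1" using assms by (rule dual_vector)
  have "\<phi> d (a + a) = 2" "\<phi> d (a + (a + a)) = 3" by (simp_all add: phi_add d)
  then show "a + a \<noteq> 0" "a + (a + a) \<noteq> 0"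
    by (auto simp: phi_right_simps)
qed

definition character :: "('a \<Rightarrow> 'k) \<Rightarrow> bool" where
  "character \<chi> \<longleftrightarrow> \<chi> 0 = 1 \<and> (\<forall>a b. \<chi> (a + b) = \<chi> a * \<chi> b)"

lemma character_nonzero: "character \<chi> \<Longrightarrow> \<chi> a \<noteq> 0"
  unfolding character_def by (metis add.right_inverse mult_zero_left zero_neq_one)

text \<open>
  The case \<open>a = b\<close> follows from the others by writing \<open>a = 2a + (-a)\<close> and \<open>0 = a + (-a)\<close>, whose
  summands differ because \<open>A\<close> is torsion free.
\<close>

lemma characterI:
  assumes one: "\<chi> 0 = 1" and mult: "\<And>a b. a \<noteq> b \<Longrightarrow> \<chi> (a + b) = \<chi> a * \<chi> b"
  shows "character \<chi>"
  unfolding character_def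
proof (intro conjI allI)
  fix a b
  show "\<chi> (a + b) = \<chi> a * \<chi> b"
  proof (cases "a = b \<and> a \<noteq> 0")
    case True
    have "a + a \<noteq> - a" "a \<noteq> - a"
      using multiple_nonzero[of a] True by (auto simp: eq_neg_iff_add_eq_0 add.assoc)
    then have "\<chi> a = \<chi> (a + a) * \<chi> (- a)" "1 = \<chi> a * \<chi> (- a)"
      using mult[of "a + a" "- a"] mult[of a "- a"] one by simp_all
    then have "\<chi> a * \<chi> a = \<chi> (a + a)" by (metis mult.assoc mult.commute mult_1)
    then show ?thesis using True by simp
  next
    case False
    then show ?thesis using mult[of a b] one by auto
  qed
qed (rule one)

text \<open>
  Multiplicativity at \<open>a \<noteq> b\<close> is read off from \<open>[t\<^sup>a\<partial>, t\<^sup>b\<partial>] = \<phi>(\<partial>,b - a) t\<^bsup>a+b\<^esup>\<partial>\<close>.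
\<close>

lemma homogeneous_character:
  assumes lin: "\<And>a. Vector_Spaces.linear scaleT scaleT (f a)"
    and f0: "\<And>d. f 0 d = d"
    and bracket: "\<And>a b d e. f (a + b) (scaleT (\<phi> d b) e - scaleT (\<phi> e a) d) =
      scaleT (\<phi> (f a d) b) (f b e) - scaleT (\<phi> (f b e) a) (f a d)"
  obtains \<chi> where "character \<chi>" "\<And>a d. f a d = scaleT (\<chi> a) d"
proof -
  have "\<exists>c. \<forall>d. f a d = scaleT c d" for a
  proof (cases "a = 0")
    case True
    then show ?thesis by (intro exI[of _ 1]) (simp add: f0)
  next
    case False
    then show ?thesis using homogeneous_scalar[OF lin f0 bracket] by blast
  qed
  then obtain \<chi> where \<chi>: "\<And>a d. f a d = scaleT (\<chi> a) d" by metis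
  have "character \<chi>"
  proof (rule characterI)
    obtain d :: 't where "d \<noteq> 0" using nontrivial by blast
    then show "\<chi> 0 = 1" using f0[of d] \<chi>[of 0 d] scale_right_imp_eq[of d "\<chi> 0" 1] by simp
    fix a b :: 'a assume "a \<noteq> b"
    then obtain d where d: "\<phi> d (b - a) = 1" using dual_vector[of "b - a"] by auto
    then have d: "\<phi> d b - \<phi> d a = 1" by (simp add: phi_right_simps)
    then have "d \<noteq> 0" by (auto simp: phi_simps)
    have s: "scaleT (\<phi> d b) d - scaleT (\<phi> d a) d = d"
      by (simp add: scale_left_diff_distrib[symmetric] d)
    have "scaleT (\<chi> (a + b)) d =
        scaleT (\<chi> a * \<chi> b * \<phi> d b) d - scaleT (\<chi> a * \<chi> b * \<phi> d a) d"
      using bracket[of a b d d] by (simp add: \<chi> s phi_simps mult_ac)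
    also have "\<dots> = scaleT (\<chi> a * \<chi> b) d"
      by (simp add: scale_left_diff_distrib[symmetric] right_diff_distrib[symmetric] d)
    finally show "\<chi> (a + b) = \<chi> a * \<chi> b" using \<open>d \<noteq> 0\<close> by simp
  qed
  then show ?thesis using \<chi> by (rule that)
qed

section \<open>The shape of an automorphism\<close>

text \<open>
  \<open>\<sigma>\<close> is the contragredient of \<open>\<tau>\<close>. Since \<open>\<phi>\<close> is nondegenerate, \<open>\<sigma>\<close> is unique and injective,
  and uniqueness makes it additive (\<open>dual_pair_unique\<close>, \<open>dual_pair_simps\<close>).
\<close>

definition dual_pair :: "('t \<Rightarrow> 't) \<Rightarrow> ('a \<Rightarrow> 'a) \<Rightarrow> bool" where
  "dual_pair \<tau> \<sigma> \<longleftrightarrow> Vector_Spaces.linear scaleT scaleT \<tau> \<and> bij \<tau> \<and> (\<forall>d a. \<phi> (\<tau> d) (\<sigma> a) = \<phi> d a)"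

lemma dual_pair_unique:
  assumes "dual_pair \<tau> \<sigma>" and "\<And>d. \<phi> (\<tau> d) \<gamma> = \<phi> d a"
  shows "\<gamma> = \<sigma> a"
proof -
  have "\<phi> d (\<gamma> - \<sigma> a) = 0" for d
  proof -
    obtain e where "d = \<tau> e" using assms(1) unfolding dual_pair_def by (metis bij_pointE)
    then show ?thesis using assms by (simp add: dual_pair_def phi_right_simps)
  qed
  then have "\<gamma> - \<sigma> a = 0" by (rule nondegenerate_right)
  then show ?thesis by simp
qed

lemma dual_pair_simps:
  assumes "dual_pair \<tau> \<sigma>"
  shows "\<sigma> 0 = 0" "\<sigma> (a + b) = \<sigma> a + \<sigma> b" "\<sigma> a = \<sigma> b \<longleftrightarrow> a = b" "\<sigma> a = 0 \<longleftrightarrow> a = 0"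
    and "\<tau> 0 = 0" "\<tau> (d - e) = \<tau> d - \<tau> e" "\<tau> (scaleT c d) = scaleT c (\<tau> d)" "\<tau> d = 0 \<longleftrightarrow> d = 0"
    and "\<tau> d = \<tau> e \<longleftrightarrow> d = e" "\<tau> (d + e) = \<tau> d + \<tau> e" "\<phi> (\<tau> d) (\<sigma> a) = \<phi> d a"
proof -
  have lin: "Vector_Spaces.linear scaleT scaleT \<tau>" and bij: "bij \<tau>"
    and dual: "\<phi> (\<tau> d) (\<sigma> a) = \<phi> d a" for d a
    using assms by (auto simp: dual_pair_def)
  interpret l: Vector_Spaces.linear scaleT scaleT \<tau> by (rule lin)
  show zero: "\<sigma> 0 = 0"
    by (rule dual_pair_unique[OF assms, symmetric]) (simp add: phi_right_simps)
  show "\<sigma> (a + b) = \<sigma> a + \<sigma> b"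
    by (rule dual_pair_unique[OF assms, symmetric]) (simp add: phi_add dual)
  show inj: "\<sigma> a = \<sigma> b \<longleftrightarrow> a = b" for a b
  proof
    assume "\<sigma> a = \<sigma> b"
    then have "\<phi> d (a - b) = 0" for d
      using dual[of d a] dual[of d b] by (simp add: phi_right_simps)
    then have "a - b = 0" by (rule nondegenerate_right)
    then show "a = b" by simp
  qed simp
  show "\<sigma> a = 0 \<longleftrightarrow> a = 0" using inj[of a 0] zero by simp
  show "\<tau> 0 = 0" "\<tau> (d - e) = \<tau> d - \<tau> e" "\<tau> (scaleT c d) = scaleT c (\<tau> d)"
    "\<tau> (d + e) = \<tau> d + \<tau> e"
    by (simp_all add: l.zero l.diff l.scale l.add)
  show "\<tau> d = \<tau> e \<longleftrightarrow> d = e" for d e using bij by (simp add: bij_is_inj inj_eq)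
  from this[of d 0] show "\<tau> d = 0 \<longleftrightarrow> d = 0" by (simp add: l.zero)
  show "\<phi> (\<tau> d) (\<sigma> a) = \<phi> d a" by (rule dual)
qed

text \<open>
  \<open>t\<^sup>aT\<close> is the weight space of \<open>T\<close> for the weight \<open>\<phi>(\<cdot>,a)\<close>, and distinct degrees have distinct weights.
  Since \<open>\<theta>\<close> maps \<open>T\<close> onto itself, it permutes the weight spaces. Composing with the inverse of
  \<open>t\<^sup>a\<partial> \<mapsto> t\<^bsup>\<sigma>a\<^esup>\<tau>\<partial>\<close> leaves a homogeneous map fixing \<open>T\<close>, to which rigidity applies.
\<close>

theorem lie_automorphism_form:
  assumes aut: "lie_automorphism (witt_scale scaleT) (witt_bracket scaleT \<phi>) \<theta>"
  obtains \<sigma> \<tau> \<chi> where "dual_pair \<tau> \<sigma>" "character \<chi>"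
    "\<And>a d. \<theta> (Poly_Mapping.single a d) = Poly_Mapping.single (\<sigma> a) (scaleT (\<chi> a) (\<tau> d))"
proof -
  have lin: "Vector_Spaces.linear (witt_scale scaleT) (witt_scale scaleT) \<theta>" and "bij \<theta>"
    and hom: "\<theta> (witt_bracket scaleT \<phi> x y) = witt_bracket scaleT \<phi> (\<theta> x) (\<theta> y)" for x y
    using aut by (auto simp: lie_automorphism_def)
  interpret l: Vector_Spaces.linear "witt_scale scaleT" "witt_scale scaleT" \<theta> by (rule lin)
  obtain \<tau> where \<tau>: "\<And>d. \<theta> (Poly_Mapping.single 0 d) = Poly_Mapping.single 0 (\<tau> d)"
    "Vector_Spaces.linear scaleT scaleT \<tau>" "bij \<tau>"
    using restrict_to_torus[OF lin \<open>bij \<theta>\<close> lie_automorphism_torus_iff[OF aut]] by blast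
  have weight: "\<phi> (\<tau> d) \<gamma> = \<phi> d a" if "\<gamma> \<in> Poly_Mapping.keys (\<theta> (Poly_Mapping.single a e))" for a e \<gamma> d
  proof -
    have "witt_bracket scaleT \<phi> (Poly_Mapping.single 0 (\<tau> d)) (\<theta> (Poly_Mapping.single a e)) =
        witt_scale scaleT (\<phi> d a) (\<theta> (Poly_Mapping.single a e))"
      by (simp add: \<tau>(1)[symmetric] hom[symmetric] bracket_torus_single l.scale)
    from arg_cong[OF this, of "\<lambda>x. Poly_Mapping.lookup x \<gamma>"] that show ?thesis
      by (simp add: lookup_bracket_torus lookup_witt_scale in_keys_iff)
  qed
  have "\<exists>\<gamma>. \<forall>d. \<phi> (\<tau> d) \<gamma> = \<phi> d a" for a
  proof -
    obtain e :: 't where "e \<noteq> 0" using nontrivial by blast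
    then have "\<theta> (Poly_Mapping.single a e) \<noteq> 0"
      using inj_eq[OF bij_is_inj[OF \<open>bij \<theta>\<close>], of "Poly_Mapping.single a e" 0]
      by (simp add: single_eq_0_iff)
    then have "Poly_Mapping.keys (\<theta> (Poly_Mapping.single a e)) \<noteq> {}" by simp
    then show ?thesis using weight by blast
  qed
  then obtain \<sigma> where \<sigma>: "\<And>a d. \<phi> (\<tau> d) (\<sigma> a) = \<phi> d a" by metis
  then have dual: "dual_pair \<tau> \<sigma>" using \<tau> by (simp add: dual_pair_def)
  note dual_simps = dual_pair_simps[OF dual]
  define f where "f a d = inv \<tau> (Poly_Mapping.lookup (\<theta> (Poly_Mapping.single a d)) (\<sigma> a))" for a d
  have f: "\<theta> (Poly_Mapping.single a d) = Poly_Mapping.single (\<sigma> a) (\<tau> (f a d))" for a d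
  proof (rule poly_mapping_eqI)
    fix \<gamma>
    have "\<tau> (f a d) = Poly_Mapping.lookup (\<theta> (Poly_Mapping.single a d)) (\<sigma> a)"
      using \<tau>(3) by (simp add: f_def bij_is_surj surj_f_inv_f)
    moreover have "Poly_Mapping.lookup (\<theta> (Poly_Mapping.single a d)) \<gamma> = 0" if "\<gamma> \<noteq> \<sigma> a"
      using dual_pair_unique[OF dual weight[of \<gamma> a d]] that by (auto simp: in_keys_iff)
    ultimately show "Poly_Mapping.lookup (\<theta> (Poly_Mapping.single a d)) \<gamma> =
        Poly_Mapping.lookup (Poly_Mapping.single (\<sigma> a) (\<tau> (f a d))) \<gamma>"
      by (auto simp: lookup_single when_def)
  qed
  have f_eq: "d' = f a d" if "\<theta> (Poly_Mapping.single a d) = Poly_Mapping.single (\<sigma> a) (\<tau> d')" for a d d'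
    using that by (simp add: f single_inject dual_simps)
  obtain \<chi> where \<chi>: "character \<chi>" "\<And>a d. f a d = scaleT (\<chi> a) d"
  proof (rule homogeneous_character[of f])
    show "Vector_Spaces.linear scaleT scaleT (f a)" for a
    proof unfold_locales
      show "f a (d + e) = f a d + f a e" for d e
        by (rule f_eq[symmetric]) (simp add: single_add l.add f dual_simps)
      show "f a (scaleT c d) = scaleT c (f a d)" for c d
        by (rule f_eq[symmetric])
          (simp add: witt_scale_single[symmetric] l.scale f dual_simps)
    qed
    show "f 0 d = d" for d
      by (rule f_eq[symmetric]) (simp add: \<tau>(1) dual_simps)
    show "f (a + b) (scaleT (\<phi> d b) e - scaleT (\<phi> e a) d) =
        scaleT (\<phi> (f a d) b) (f b e) - scaleT (\<phi> (f b e) a) (f a d)" for a b d e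
    proof (rule f_eq[symmetric])
      have "\<theta> (monomial_bracket a d b e) =
          witt_bracket scaleT \<phi> (Poly_Mapping.single (\<sigma> a) (\<tau> (f a d))) (Poly_Mapping.single (\<sigma> b) (\<tau> (f b e)))"
        by (simp add: witt_bracket_single[symmetric] hom f)
      also have "\<dots> = Poly_Mapping.single (\<sigma> (a + b))
          (\<tau> (scaleT (\<phi> (f a d) b) (f b e) - scaleT (\<phi> (f b e) a) (f a d)))"
        by (simp add: witt_bracket_single dual_simps)
      finally show "\<theta> (monomial_bracket a d b e) = Poly_Mapping.single (\<sigma> (a + b))
          (\<tau> (scaleT (\<phi> (f a d) b) (f b e) - scaleT (\<phi> (f b e) a) (f a d)))" .
    qed
  qed blast
  show ?thesis
    by (rule that[OF dual \<chi>(1)]) (simp add: f \<chi>(2) dual_simps)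
qed

lemma lie_automorphism_of_form:
  assumes lin: "Vector_Spaces.linear (witt_scale scaleT) (witt_scale scaleT) \<theta>" and "bij \<theta>"
    and dual: "dual_pair \<tau> \<sigma>" and char: "character \<chi>"
    and form: "\<And>a d. \<theta> (Poly_Mapping.single a d) = Poly_Mapping.single (\<sigma> a) (scaleT (\<chi> a) (\<tau> d))"
  shows "lie_automorphism (witt_scale scaleT) (witt_bracket scaleT \<phi>) \<theta>"
  unfolding lie_automorphism_def
proof (intro conjI allI lin \<open>bij \<theta>\<close>)
  interpret l: Vector_Spaces.linear "witt_scale scaleT" "witt_scale scaleT" \<theta> by (rule lin)
  note dual_simps = dual_pair_simps[OF dual]
  have monomial: "\<theta> (witt_bracket scaleT \<phi> (Poly_Mapping.single a d) (Poly_Mapping.single b e)) =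
      witt_bracket scaleT \<phi> (\<theta> (Poly_Mapping.single a d)) (\<theta> (Poly_Mapping.single b e))" for a b d e
    using char
    by (simp add: witt_bracket_single form character_def dual_simps phi_simps
        scale_right_diff_distrib mult_ac)
  have single: "\<theta> (witt_bracket scaleT \<phi> (Poly_Mapping.single a d) y) =
      witt_bracket scaleT \<phi> (\<theta> (Poly_Mapping.single a d)) (\<theta> y)" for a d y
    by (induction y rule: poly_mapping_additive_induct)
      (simp_all add: monomial witt_bracket_add_right l.add l.zero witt_bracket_zero)
  show "\<theta> (witt_bracket scaleT \<phi> x y) = witt_bracket scaleT \<phi> (\<theta> x) (\<theta> y)" for x y
    by (induction x rule: poly_mapping_additive_induct)
      (simp_all add: single witt_bracket_add_left l.add l.zero witt_bracket_zero)
qed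

section \<open>Local automorphisms\<close>

context
  fixes \<Phi> :: "('a \<Rightarrow>\<^sub>0 't) \<Rightarrow> ('a \<Rightarrow>\<^sub>0 't)" and P :: "'t \<Rightarrow> 't"
  assumes local_aut: "local_lie_automorphism (witt_scale scaleT) (witt_bracket scaleT \<phi>) \<Phi>"
    and bij_Phi: "bij \<Phi>"
    and Phi_torus: "\<And>d. \<Phi> (Poly_Mapping.single 0 d) = Poly_Mapping.single 0 (P d)"
    and P_linear: "Vector_Spaces.linear scaleT scaleT P"
    and P_bij: "bij P"
begin

lemma Phi_linear: "Vector_Spaces.linear (witt_scale scaleT) (witt_scale scaleT) \<Phi>"
  using local_aut by (simp add: local_lie_automorphism_def)

interpretation Phi: Vector_Spaces.linear "witt_scale scaleT" "witt_scale scaleT" \<Phi>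
  by (rule Phi_linear)

text \<open>
  The automorphism realising \<open>\<Phi>\<close> at \<open>x\<close>, in its standard shape. All of its data depend on \<open>x\<close>.
\<close>

lemma pointwise_form:
  obtains \<theta> \<sigma> \<tau> \<chi> where "dual_pair \<tau> \<sigma>" "character \<chi>"
    "Vector_Spaces.linear (witt_scale scaleT) (witt_scale scaleT) \<theta>" "\<Phi> x = \<theta> x"
    "\<forall>a d. \<theta> (Poly_Mapping.single a d) = Poly_Mapping.single (\<sigma> a) (scaleT (\<chi> a) (\<tau> d))"
proof -
  obtain \<theta> where \<theta>: "lie_automorphism (witt_scale scaleT) (witt_bracket scaleT \<phi>) \<theta>" "\<Phi> x = \<theta> x"
    using local_aut unfolding local_lie_automorphism_def by blast
  then have lin: "Vector_Spaces.linear (witt_scale scaleT) (witt_scale scaleT) \<theta>"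
    by (simp add: lie_automorphism_def)
  show ?thesis
  proof (rule lie_automorphism_form[OF \<theta>(1)])
    fix \<sigma> \<tau> \<chi>
    assume "dual_pair \<tau> \<sigma>" "character \<chi>"
      "\<And>a d. \<theta> (Poly_Mapping.single a d) = Poly_Mapping.single (\<sigma> a) (scaleT (\<chi> a) (\<tau> d))"
    then show ?thesis using that[OF _ _ lin \<theta>(2)] by simp
  qed
qed

text \<open>
  \<open>\<Phi>\<close> maps \<open>t\<^sup>a e\<close> to a monomial of nonzero degree \<open>\<gamma>\<close>. Adding \<open>d \<in> T\<close> to \<open>t\<^sup>a e\<close> yields an element whose
  realising automorphism has \<open>\<tau>d = Pd\<close> and \<open>\<sigma>a = \<gamma>\<close>; so \<open>\<gamma>\<close> is determined by \<open>P\<close> and \<open>a\<close>.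
\<close>

lemma Phi_monomial:
  assumes "a \<noteq> 0" "e \<noteq> 0"
  obtains \<gamma> v where "\<Phi> (Poly_Mapping.single a e) = Poly_Mapping.single \<gamma> v"
    "\<And>d. \<phi> (P d) \<gamma> = \<phi> d a"
proof -
  let ?x = "Poly_Mapping.single a e"
  obtain \<theta> \<sigma> \<tau> \<chi> where form: "dual_pair \<tau> \<sigma>" "character \<chi>"
    "Vector_Spaces.linear (witt_scale scaleT) (witt_scale scaleT) \<theta>" "\<Phi> ?x = \<theta> ?x"
    "\<forall>a d. \<theta> (Poly_Mapping.single a d) = Poly_Mapping.single (\<sigma> a) (scaleT (\<chi> a) (\<tau> d))"
    by (rule pointwise_form)
  define \<gamma> v where "\<gamma> = \<sigma> a" and "v = scaleT (\<chi> a) (\<tau> e)"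
  have \<gamma>: "\<gamma> \<noteq> 0" and v: "v \<noteq> 0" and Phi: "\<Phi> ?x = Poly_Mapping.single \<gamma> v"
    using assms form by (auto simp: \<gamma>_def v_def dual_pair_simps[OF form(1)] character_nonzero)
  have "\<phi> (P d) \<gamma> = \<phi> d a" for d
  proof -
    let ?y = "Poly_Mapping.single 0 d + Poly_Mapping.single a e"
    obtain \<theta> \<sigma> \<tau> \<chi> where form: "dual_pair \<tau> \<sigma>" "character \<chi>"
      "Vector_Spaces.linear (witt_scale scaleT) (witt_scale scaleT) \<theta>" "\<Phi> ?y = \<theta> ?y"
      "\<forall>a d. \<theta> (Poly_Mapping.single a d) = Poly_Mapping.single (\<sigma> a) (scaleT (\<chi> a) (\<tau> d))"
      by (rule pointwise_form)
    interpret l: Vector_Spaces.linear "witt_scale scaleT" "witt_scale scaleT" \<theta> by (rule form)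
    note simps = dual_pair_simps[OF form(1)]
    have eq: "Poly_Mapping.single 0 (P d) + Poly_Mapping.single \<gamma> v =
        Poly_Mapping.single 0 (\<tau> d) + Poly_Mapping.single (\<sigma> a) (scaleT (\<chi> a) (\<tau> e))"
      using form(2,4) by (simp add: Phi.add l.add Phi_torus Phi form(5) simps character_def)
    have "\<sigma> a \<noteq> 0" using assms(1) by (simp add: simps)
    have "P d = \<tau> d"
      using arg_cong[OF eq, of "\<lambda>x. Poly_Mapping.lookup x 0"] \<gamma> \<open>\<sigma> a \<noteq> 0\<close>
      by (simp add: lookup_add lookup_single when_def)
    moreover have "\<gamma> = \<sigma> a"
      using arg_cong[OF eq, of "\<lambda>x. Poly_Mapping.lookup x \<gamma>"] \<gamma> v
      by (simp add: lookup_add lookup_single when_def split: if_splits)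
    ultimately show ?thesis by (simp add: simps)
  qed
  with Phi show ?thesis by (rule that)
qed

lemma Phi_graded:
  obtains \<sigma> Q where "dual_pair P \<sigma>"
    "\<And>a e. \<Phi> (Poly_Mapping.single a e) = Poly_Mapping.single (\<sigma> a) (Q a e)"
proof -
  have "\<exists>\<gamma>. \<forall>d. \<phi> (P d) \<gamma> = \<phi> d a" for a
  proof (cases "a = 0")
    case True
    then show ?thesis by (intro exI[of _ 0]) (simp add: phi_right_simps)
  next
    case False
    then show ?thesis using nontrivial Phi_monomial by metis
  qed
  then obtain \<sigma> where "\<And>a d. \<phi> (P d) (\<sigma> a) = \<phi> d a" by metis
  then have dual: "dual_pair P \<sigma>" using P_linear P_bij by (simp add: dual_pair_def)
  have "\<exists>v. \<Phi> (Poly_Mapping.single a e) = Poly_Mapping.single (\<sigma> a) v" for a e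
  proof (cases "a = 0 \<or> e = 0")
    case True
    then show ?thesis
      using Phi_torus dual_pair_simps(1)[OF dual] by (auto intro: exI[of _ 0])
  next
    case False
    then obtain \<gamma> v where "\<Phi> (Poly_Mapping.single a e) = Poly_Mapping.single \<gamma> v"
      "\<And>d. \<phi> (P d) \<gamma> = \<phi> d a"
      using Phi_monomial by metis
    then show ?thesis using dual_pair_unique[OF dual, of \<gamma> a] by blast
  qed
  then obtain Q where "\<And>a e. \<Phi> (Poly_Mapping.single a e) = Poly_Mapping.single (\<sigma> a) (Q a e)"
    by metis
  with dual show ?thesis by (rule that)
qed

context
  fixes \<sigma> :: "'a \<Rightarrow> 'a" and Q :: "'a \<Rightarrow> 't \<Rightarrow> 't"
  assumes dual: "dual_pair P \<sigma>"
    and Phi_single: "\<And>a e. \<Phi> (Poly_Mapping.single a e) = Poly_Mapping.single (\<sigma> a) (Q a e)"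
begin

text \<open>
  The realising automorphism at \<open>\<delta> + \<Sum>\<^sub>s t\<^sup>s d\<^sub>s\<close>, with degree map \<open>\<rho>\<close>, satisfies \<open>\<tau>\<delta> = P\<delta>\<close> and \<open>\<rho>(S) \<subseteq> \<sigma>(S)\<close>.
  If \<open>\<rho>s = \<sigma>s'\<close>, then duality gives \<open>\<phi>(\<delta>,s) = \<phi>(\<delta>,s')\<close>, so \<open>s = s'\<close> by the choice of \<open>\<delta>\<close>. Thus \<open>\<rho>\<close> agrees
  with \<open>\<sigma>\<close> on \<open>S\<close>. The vectors \<open>d\<^sub>s\<close> may vary with \<open>s\<close>, which is used to compare scalars below.
\<close>

lemma simultaneous_form:
  assumes S: "finite S" "0 \<notin> S" and d: "\<And>s. s \<in> S \<Longrightarrow> d s \<noteq> 0"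
  obtains \<tau> \<chi> where "character \<chi>" "\<forall>u\<in>S. \<forall>e. \<phi> (\<tau> e) (\<sigma> u) = \<phi> e u"
    "\<forall>s\<in>S. Q s (d s) = scaleT (\<chi> s) (\<tau> (d s))"
proof -
  obtain \<delta> where inj: "inj_on (\<phi> \<delta>) S" using S(1) by (rule separating_vector)
  let ?x = "Poly_Mapping.single 0 \<delta> + (\<Sum>s\<in>S. Poly_Mapping.single s (d s))"
  obtain \<theta> \<rho> \<tau> \<chi> where form: "dual_pair \<tau> \<rho>" "character \<chi>"
    "Vector_Spaces.linear (witt_scale scaleT) (witt_scale scaleT) \<theta>" "\<Phi> ?x = \<theta> ?x"
    "\<forall>a d. \<theta> (Poly_Mapping.single a d) = Poly_Mapping.single (\<rho> a) (scaleT (\<chi> a) (\<tau> d))"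
    by (rule pointwise_form)
  interpret l: Vector_Spaces.linear "witt_scale scaleT" "witt_scale scaleT" \<theta> by (rule form)
  note simps = dual_pair_simps[OF form(1)] and P_simps = dual_pair_simps[OF dual]
  have eq: "Poly_Mapping.single 0 (P \<delta>) + (\<Sum>s\<in>S. Poly_Mapping.single (\<sigma> s) (Q s (d s))) =
      Poly_Mapping.single 0 (\<tau> \<delta>) + (\<Sum>s\<in>S. Poly_Mapping.single (\<rho> s) (scaleT (\<chi> s) (\<tau> (d s))))"
    (is "?l = ?r")
  proof -
    have "?l = \<Phi> ?x" by (simp add: Phi.add Phi.sum Phi_torus Phi_single[symmetric])
    also have "\<dots> = ?r"
      unfolding form(4) l.add l.sum form(5)[rule_format] using form(2) by (simp add: simps character_def)
    finally show ?thesis .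
  qed
  have lookup_image: "(\<Sum>s\<in>S. Poly_Mapping.lookup (Poly_Mapping.single (\<mu> s) (g s)) \<gamma>) =
      (\<Sum>s\<in>{s\<in>S. \<mu> s = \<gamma>}. g s)" for \<mu> :: "'a \<Rightarrow> 'a" and g :: "'a \<Rightarrow> 't" and \<gamma>
    using S(1) by (simp add: sum.inter_filter lookup_single when_def)
  have l0: "Poly_Mapping.lookup ?l \<gamma> = (if \<gamma> = 0 then P \<delta> else 0) + (\<Sum>s\<in>{s\<in>S. \<sigma> s = \<gamma>}. Q s (d s))" for \<gamma>
    by (simp add: lookup_add lookup_sum lookup_image) (simp add: lookup_single when_def)
  have r0: "Poly_Mapping.lookup ?r \<gamma> =
      (if \<gamma> = 0 then \<tau> \<delta> else 0) + (\<Sum>s\<in>{s\<in>S. \<rho> s = \<gamma>}. scaleT (\<chi> s) (\<tau> (d s)))" for \<gamma>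
    by (simp add: lookup_add lookup_sum lookup_image) (simp add: lookup_single when_def)
  have none: "{s\<in>S. \<sigma> s = 0} = {}" "{s\<in>S. \<rho> s = 0} = {}"
    using S(2) by (auto simp: simps P_simps)
  have P_delta: "P \<delta> = \<tau> \<delta>"
    using arg_cong[OF eq, of "\<lambda>x. Poly_Mapping.lookup x 0"] unfolding l0 r0 none by simp
  have \<rho>: "\<rho> s = \<sigma> s" if s: "s \<in> S" for s
  proof -
    have "{s'\<in>S. \<rho> s' = \<rho> s} = {s}" using s by (auto simp: simps)
    moreover have "\<rho> s \<noteq> 0" using s S(2) by (auto simp: simps)
    ultimately have "(\<Sum>s'\<in>{s'\<in>S. \<sigma> s' = \<rho> s}. Q s' (d s')) = scaleT (\<chi> s) (\<tau> (d s))"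
      using arg_cong[OF eq, of "\<lambda>x. Poly_Mapping.lookup x (\<rho> s)"] unfolding l0 r0 by simp
    also have "\<dots> \<noteq> 0" using d[OF s] character_nonzero[OF form(2)] by (simp add: simps)
    finally have "{s'\<in>S. \<sigma> s' = \<rho> s} \<noteq> {}" by (metis sum.empty)
    then obtain s' where s': "s' \<in> S" "\<sigma> s' = \<rho> s" by blast
    have "\<phi> \<delta> s' = \<phi> (P \<delta>) (\<rho> s)" by (simp add: s'(2)[symmetric] P_simps)
    also have "\<dots> = \<phi> \<delta> s" by (simp add: P_delta simps)
    finally have "s' = s" using inj s s'(1) by (simp add: inj_on_eq_iff)
    then show ?thesis using s'(2) by simp
  qed
  show ?thesis
  proof (rule that[OF form(2)]; intro ballI allI)
    show "\<phi> (\<tau> e) (\<sigma> u) = \<phi> e u" if u: "u \<in> S" for e u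
      using \<rho>[OF u] simps(11)[of e u] by simp
    fix s assume s: "s \<in> S"
    have "{s'\<in>S. \<rho> s' = \<rho> s} = {s}" "{s'\<in>S. \<sigma> s' = \<rho> s} = {s}" "\<rho> s \<noteq> 0"
      using s S(2) \<rho> by (auto simp: simps P_simps)
    then show "Q s (d s) = scaleT (\<chi> s) (\<tau> (d s))"
      using arg_cong[OF eq, of "\<lambda>x. Poly_Mapping.lookup x (\<rho> s)"] unfolding l0 r0 by simp
  qed
qed

text \<open>
  For \<open>\<phi>(e,u\<^sub>0) \<noteq> 0\<close>, the scalar \<open>c\<close> is read off in degree \<open>u\<^sub>0\<close>. Any further degree \<open>u\<close> can be controlled
  together with \<open>a\<close> and \<open>u\<^sub>0\<close>, so \<open>Q\<^sub>a e\<close> and \<open>c P e\<close> pair equally with \<open>\<sigma>u\<close> for every \<open>u\<close>.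
\<close>

lemma Q_proportional:
  assumes "a \<noteq> 0"
  shows "\<exists>c. Q a e = scaleT c (P e)"
proof (cases "e = 0")
  case True
  have "Poly_Mapping.single (\<sigma> a) (Q a 0) = 0" using Phi_single[of a 0] by simp
  then show ?thesis using True by (simp add: single_eq_0_iff dual_pair_simps[OF dual])
next
  case False
  then obtain u0 where u0: "\<phi> e u0 \<noteq> 0" using nondegenerate_left by blast
  define c where "c = \<phi> (Q a e) (\<sigma> u0) / \<phi> e u0"
  note P_simps = dual_pair_simps[OF dual]
  obtain w where w: "P w = Q a e - scaleT c (P e)"
    using P_bij by (metis bij_pointE)
  have "\<phi> w u = 0" for u
  proof (cases "u = 0")
    case True
    then show ?thesis by (simp add: phi_right_simps)
  next
    case u: False
    have "u0 \<noteq> 0" using u0 by (auto simp: phi_right_simps)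
    obtain \<tau> \<chi> where *: "\<forall>s\<in>{a, u0, u}. \<forall>e'. \<phi> (\<tau> e') (\<sigma> s) = \<phi> e' s"
      "\<forall>s\<in>{a, u0, u}. Q s e = scaleT (\<chi> s) (\<tau> e)"
      by (rule simultaneous_form[of "{a, u0, u}" "\<lambda>_. e"])
        (use \<open>a \<noteq> 0\<close> \<open>u0 \<noteq> 0\<close> u False in auto)
    have "\<phi> (Q a e) (\<sigma> s) = \<chi> a * \<phi> e s" if "s \<in> {a, u0, u}" for s
      using *(2) bspec[OF *(1) that] by (simp add: phi_simps)
    then have "c = \<chi> a" "\<phi> (Q a e) (\<sigma> u) = \<chi> a * \<phi> e u" using u0 by (auto simp: c_def)
    then have "\<phi> (P w) (\<sigma> u) = 0" by (simp add: w phi_simps P_simps)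
    then show ?thesis by (simp add: P_simps)
  qed
  then have "w = 0" by (rule nondegenerate_left)
  then show ?thesis using w P_simps by (intro exI[of _ c]) simp
qed

text \<open>
  The scalars compare \<open>Q\<^sub>s\<close> with \<open>P\<close>, whereas the realising automorphism provides a multiple of its own
  \<open>\<tau>\<close>. Adding to \<open>S\<close> a degree \<open>w\<^sub>s\<close> that detects \<open>d\<^sub>s\<close> identifies the two scalars.
\<close>

lemma coefficients_character:
  assumes c: "\<And>a e. a \<noteq> 0 \<Longrightarrow> Q a e = scaleT (c a e) (P e)"
    and S: "finite S" "0 \<notin> S" and d: "\<And>s. d s \<noteq> 0"
  obtains \<chi> where "character \<chi>" "\<forall>s\<in>S. c s (d s) = \<chi> s"
proof -
  note P_simps = dual_pair_simps[OF dual]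
  have "\<exists>u. \<phi> (d s) u \<noteq> 0" for s using d nondegenerate_left by blast
  then obtain w where w: "\<And>s. \<phi> (d s) (w s) \<noteq> 0" by metis
  have "w s \<noteq> 0" for s using w[of s] by (auto simp: phi_right_simps)
  then have *: "finite (S \<union> w ` S)" "0 \<notin> S \<union> w ` S" using S by (auto simp: image_iff)
  obtain \<tau> \<chi> where form: "character \<chi>" "\<forall>u\<in>S \<union> w ` S. \<forall>e. \<phi> (\<tau> e) (\<sigma> u) = \<phi> e u"
    "\<forall>s\<in>S \<union> w ` S. Q s (d s) = scaleT (\<chi> s) (\<tau> (d s))"
    by (rule simultaneous_form[OF * d])
  have "\<forall>s\<in>S. c s (d s) = \<chi> s"
  proof
    fix s assume s: "s \<in> S"
    then have "s \<noteq> 0" using S(2) by auto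
    then have "scaleT (c s (d s)) (P (d s)) = scaleT (\<chi> s) (\<tau> (d s))"
      using c[of s "d s"] form(3) s by auto
    from arg_cong[OF this, of "\<lambda>v. \<phi> v (\<sigma> (w s))"] show "c s (d s) = \<chi> s"
      using form(2) s w[of s] by (simp add: phi_simps P_simps)
  qed
  with form(1) show ?thesis by (rule that)
qed

text \<open>
  A scalar that might depend on the vector \<open>e\<close> is compared with scalars of a fixed vector \<open>d\<^sub>0\<close> through
  \<open>a = 2a + (-a)\<close>: the three degrees are distinct and nonzero, so the vectors in them can be chosen
  independently.
\<close>

lemma Q_character:
  obtains X where "character X" "\<And>a e. Q a e = scaleT (X a) (P e)"
proof -
  note P_simps = dual_pair_simps[OF dual]
  obtain d0 :: 't where d0: "d0 \<noteq> 0" using nontrivial by blast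
  have "\<forall>a e. \<exists>c. a \<noteq> 0 \<longrightarrow> Q a e = scaleT c (P e)" using Q_proportional by blast
  then obtain c where c: "\<And>a e. a \<noteq> 0 \<Longrightarrow> Q a e = scaleT (c a e) (P e)" by metis
  have indep: "c a e = c a d0" if "a \<noteq> 0" "e \<noteq> 0" for a e
  proof -
    have mult: "a + a \<noteq> 0" "a + a \<noteq> a" "- a \<noteq> a" "- a \<noteq> 0"
      using multiple_nonzero[OF \<open>a \<noteq> 0\<close>] \<open>a \<noteq> 0\<close> by (auto simp: eq_neg_iff_add_eq_0 neg_eq_iff_add_eq_0)
    have "c a v = c (a + a) d0 * c (- a) d0" if "v \<noteq> 0" for v
    proof -
      obtain \<chi> where \<chi>: "character \<chi>"
        "\<forall>s\<in>{a, a + a, - a}. c s (if s = a then v else d0) = \<chi> s"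
        by (rule coefficients_character[of c "{a, a + a, - a}" "\<lambda>s. if s = a then v else d0"])
          (use c mult \<open>a \<noteq> 0\<close> \<open>v \<noteq> 0\<close> d0 in auto)
      have "c a v = \<chi> a" "c (a + a) d0 = \<chi> (a + a)" "c (- a) d0 = \<chi> (- a)"
        using \<chi>(2) mult by simp_all
      moreover have "\<chi> a = \<chi> (a + a) * \<chi> (- a)"
        using \<chi>(1) unfolding character_def by (metis add.assoc add.right_inverse add.right_neutral)
      ultimately show ?thesis by simp
    qed
    then show ?thesis using \<open>e \<noteq> 0\<close> d0 by metis
  qed
  define X where "X a = (if a = 0 then 1 else c a d0)" for a
  have "Q a e = scaleT (X a) (P e)" for a e
  proof -
    consider "a = 0" | "a \<noteq> 0" "e = 0" | "a \<noteq> 0" "e \<noteq> 0" by blast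
    then show ?thesis
    proof cases
      case 1
      then show ?thesis using Phi_single[of 0 e] Phi_torus[of e] by (simp add: X_def P_simps single_inject)
    next
      case 2
      then show ?thesis using c[of a e] by (simp add: P_simps)
    next
      case 3
      then show ?thesis using c[of a e] indep by (simp add: X_def)
    qed
  qed
  moreover have "character X"
    unfolding character_def
  proof (intro conjI allI)
    show "X 0 = 1" by (simp add: X_def)
    fix a b :: 'a
    let ?S = "{a, b, a + b} - {0}"
    \<comment> \<open>Degree \<open>0\<close> is left out of \<open>S\<close>; there \<open>X\<close> and \<open>\<chi>\<close> are both \<open>1\<close>.\<close>
    obtain \<chi> where \<chi>: "character \<chi>" "\<forall>s\<in>?S. c s d0 = \<chi> s"
      by (rule coefficients_character[of c ?S "\<lambda>_. d0"]) (use c d0 in auto)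
    have "X s = \<chi> s" if "s \<in> {a, b, a + b}" for s
      using \<chi> that by (cases "s = 0") (auto simp: X_def character_def)
    then show "X (a + b) = X a * X b" using \<chi>(1) by (simp add: character_def)
  qed
  ultimately show ?thesis using that by blast
qed

end

end

theorem bijective_local_lie_automorphism:
  assumes local_aut: "local_lie_automorphism (witt_scale scaleT) (witt_bracket scaleT \<phi>) \<Phi>"
    and "bij \<Phi>"
  shows "lie_automorphism (witt_scale scaleT) (witt_bracket scaleT \<phi>) \<Phi>"
proof -
  have lin: "Vector_Spaces.linear (witt_scale scaleT) (witt_scale scaleT) \<Phi>"
    using local_aut by (simp add: local_lie_automorphism_def)
  have torus: "(\<exists>e. \<Phi> x = Poly_Mapping.single 0 e) \<longleftrightarrow> (\<exists>d. x = Poly_Mapping.single 0 d)" for x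
  proof -
    obtain \<theta> where "lie_automorphism (witt_scale scaleT) (witt_bracket scaleT \<phi>) \<theta>" "\<Phi> x = \<theta> x"
      using local_aut unfolding local_lie_automorphism_def by blast
    then show ?thesis using lie_automorphism_torus_iff by simp
  qed
  obtain P where P: "\<And>d. \<Phi> (Poly_Mapping.single 0 d) = Poly_Mapping.single 0 (P d)"
    "Vector_Spaces.linear scaleT scaleT P" "bij P"
    using restrict_to_torus[OF lin \<open>bij \<Phi>\<close> torus] by blast
  note context_facts = local_aut \<open>bij \<Phi>\<close> P
  obtain \<sigma> Q where Q: "dual_pair P \<sigma>"
    "\<And>a e. \<Phi> (Poly_Mapping.single a e) = Poly_Mapping.single (\<sigma> a) (Q a e)"
    using Phi_graded[OF context_facts] by blast
  obtain X where X: "character X" "\<And>a e. Q a e = scaleT (X a) (P e)"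
    using Q_character[OF context_facts Q] by blast
  show ?thesis
    by (rule lie_automorphism_of_form[OF lin \<open>bij \<Phi>\<close> Q(1) X(1)]) (simp add: Q(2) X(2))
qed

end

theorem theorem3p4:
  fixes scaleT :: "'k::field_char_0 \<Rightarrow> 't::ab_group_add \<Rightarrow> 't"
    and \<phi> :: "'t \<Rightarrow> 'a::ab_group_add \<Rightarrow> 'k"
    and \<Phi> :: "('a \<Rightarrow>\<^sub>0 't) \<Rightarrow> ('a \<Rightarrow>\<^sub>0 't)"
  assumes "witt_datum scaleT \<phi>"
    and "simple_lie_algebra (witt_scale scaleT)
           (witt_bracket scaleT \<phi> :: ('a \<Rightarrow>\<^sub>0 't) \<Rightarrow> ('a \<Rightarrow>\<^sub>0 't) \<Rightarrow> ('a \<Rightarrow>\<^sub>0 't))"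
    and "local_lie_automorphism (witt_scale scaleT) (witt_bracket scaleT \<phi>) \<Phi>"
    and "bij \<Phi>"
  shows "lie_automorphism (witt_scale scaleT) (witt_bracket scaleT \<phi>) \<Phi>"
proof -
  interpret witt_datum scaleT \<phi> by fact
  obtain d0 :: 't where "d0 \<noteq> 0" using simple_imp_nontrivial[OF assms(2)] by blast
  interpret nondegenerate_witt_datum scaleT \<phi>
  proof unfold_locales
    show "a = 0" if "\<And>d. \<phi> d a = 0" for a
      using assms(2) that \<open>d0 \<noteq> 0\<close> by (rule simple_imp_nondegenerate_right)
    show "d = 0" if "\<And>a. \<phi> d a = 0" for d
      using assms(2) that by (rule simple_imp_nondegenerate_left)
    show "\<exists>d::'t. d \<noteq> 0" using \<open>d0 \<noteq> 0\<close> by blast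
  qed
  show ?thesis using assms(3,4) by (rule bijective_local_lie_automorphism)
qed


end
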